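(* For every integer $d\ge 2$ there is a positive constant $\kappa_d$, depending only on $d$ (in particular independent of $R$ and $A$), such that the following holds for all sufficiently large real numbers $R$ and $A$ (i.e. for all $R\ge R_0$, $A\ge A_0$, for some thresholds $R_0,A_0$ depending only on $d$). Let $\eta$ be any initial configuration of $\lfloor A R^d\rfloor$ explorers lying in $\mathbb{B}(0,R/2)$, that is, $\eta:\mathbb{Z}^d\to\mathbb{N}$ vanishes outside $\mathbb{B}(0,R/2)$ and $\sum_{z}\eta(z)=\lfloor AR^d\rfloor$, and let $A(\eta)$ be the internal DLA cluster they produce. If $d\ge 3$, then $$P\big(\mathbb{B}(0,R)\not\subset A(\eta)\big)\le \exp\big(-\kappa_d A R^2\big),$$ and if $d=2$, then $$P\big(\mathbb{B}(0,R)\not\subset A(\eta)\big)\le \exp\Big(-\kappa_2\frac{A R^2}{\log(R)}\Big).$$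
   Context: Notation. $\|\cdot\|$ is the Euclidean norm on $\mathbb{R}^d$; $\mathbb{B}(x,r)=\{y\in\mathbb{Z}^d:\|y-x\|<r\}$; $\lfloor x\rfloor$ is the integer part of $x$; $\mathbb{N}$ includes $0$. Internal DLA from a configuration. A configuration $\eta\in\mathbb{N}^{\mathbb{Z}^d}$ with $N=\sum_z\eta(z)<\infty$ represents the starting positions of $N$ explorers, $\eta(z)$ of them starting at $z$. Enumerate the starting positions (with multiplicity) as $x_1,\dots,x_N$, and let $S_1,\dots,S_N$ be independent discrete-time simple random walks on $\mathbb{Z}^d$ with $S_k(0)=x_k$. Set $A_0=\varnothing$ and, for $k=1,\dots,N$, $\tau_k=\inf\{t\ge 0:S_k(t)\notin A_{k-1}\}$ and $A_k=A_{k-1}\cup\{S_k(\tau_k)\}$. The cluster produced is $A(\eta)=A_N$ (its law does not depend on the chosen enumeration). *)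

theory Defs
  imports "HOL-Probability.Probability" "HOL-Library.Multiset"
begin

text \<open>
  The lattice Z^d is the type \<open>int ^ 'd\<close> with \<open>d = CARD('d)\<close>. A configuration of finitely many
  explorers is a multiset of lattice points: \<open>count \<eta> z\<close> explorers start at \<open>z\<close>, and \<open>size \<eta>\<close> is
  their total number.
\<close>

definition lattice_ball :: "int ^ 'd \<Rightarrow> real \<Rightarrow> (int ^ 'd) set" where
  "lattice_ball x r = {y. norm ((\<chi> i. real_of_int (y $ i - x $ i)) :: real ^ 'd) < r}"

definition unit_steps :: "(int ^ 'd) set" where
  "unit_steps = {axis i c | i c. c \<in> {- 1, 1}}"

lemma finite_unit_steps: "finite (unit_steps :: (int ^ 'd) set)"
proof (rule finite_subset)
  show "(unit_steps :: (int ^ 'd) set) \<subseteq> (\<lambda>(i, c). axis i c) ` (UNIV \<times> {- 1, 1})"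
    by (auto simp: unit_steps_def)
  show "finite ((\<lambda>(i, c). axis i c :: int ^ 'd) ` (UNIV \<times> {- 1, 1}))"
    by (intro finite_imageI finite_cartesian_product) auto
qed

lemma unit_steps_nonempty: "(unit_steps :: (int ^ 'd) set) \<noteq> {}"
  by (auto simp: unit_steps_def)

text \<open>
  Sample space: i.i.d. uniform unit steps, \<open>\<xi> (k, i)\<close> being the \<open>i\<close>-th step of the \<open>k\<close>-th walk
  (both indices counted from 0). The list \<open>xs\<close> gives the starting points of the walks; only the
  walks with index below \<open>length xs\<close> are ever used.
\<close>

definition walk_steps :: "(nat \<times> nat \<Rightarrow> int ^ 'd) measure" where
  "walk_steps = Pi\<^sub>M UNIV (\<lambda>_. measure_pmf (pmf_of_set unit_steps))"

definition walks :: "(int ^ 'd) list \<Rightarrow> (nat \<times> nat \<Rightarrow> int ^ 'd) \<Rightarrow> nat \<Rightarrow> nat \<Rightarrow> int ^ 'd" where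
  "walks xs \<xi> k t = xs ! k + (\<Sum>i<t. \<xi> (k, i))"

text \<open>
  An explorer whose trajectory \<open>s\<close> never leaves \<open>C\<close> (infinite exit time; for a finite \<open>C\<close> an event
  of probability zero) settles nowhere.
\<close>

definition settle :: "(nat \<Rightarrow> 'a) \<Rightarrow> 'a set \<Rightarrow> 'a set" where
  "settle s C = (if \<exists>t. s t \<notin> C then insert (s (LEAST t. s t \<notin> C)) C else C)"

primrec idla :: "(nat \<Rightarrow> nat \<Rightarrow> 'a) \<Rightarrow> nat \<Rightarrow> 'a set" where
  "idla S 0 = {}"
| "idla S (Suc k) = settle (S k) (idla S k)"

definition idla_cluster :: "(int ^ 'd) list \<Rightarrow> (nat \<times> nat \<Rightarrow> int ^ 'd) \<Rightarrow> (int ^ 'd) set" where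
  "idla_cluster xs \<xi> = idla (walks xs \<xi>) (length xs)"

lemma prob_space_walk_steps: "prob_space walk_steps"
  unfolding walk_steps_def by (intro prob_space_PiM prob_space_measure_pmf)

lemma space_walk_steps [simp]: "space walk_steps = UNIV"
  by (simp add: walk_steps_def space_PiM)

lemma countable_lattice: "countable (UNIV :: (int ^ 'd) set)"
proof -
  have "inj (vec_nth :: int ^ 'd \<Rightarrow> 'd \<Rightarrow> int)"
    by (simp add: inj_on_def vec_eq_iff)
  moreover have "countable (range (vec_nth :: int ^ 'd \<Rightarrow> 'd \<Rightarrow> int))"
    by simp
  ultimately show ?thesis
    using countable_image_inj_on by blast
qed

lemma sets_walks:
  fixes xs :: "(int ^ 'd) list"
  shows "{\<xi>. walks xs \<xi> k t = z} \<in> sets walk_steps"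
proof (induction t arbitrary: z)
  case 0
  then show ?case
    using sets.top[of "walk_steps :: (nat \<times> nat \<Rightarrow> int ^ 'd) measure"]
    by (cases "xs ! k = z") (auto simp: walks_def)
next
  case (Suc t)
  have step: "{\<xi>. \<xi> (k, t) = y} \<in> sets walk_steps" for y :: "int ^ 'd"
  proof -
    have "(\<lambda>\<xi>. \<xi> (k, t)) -` {y} \<inter> space walk_steps \<in> sets walk_steps"
      unfolding walk_steps_def
      by (rule measurable_sets[OF measurable_component_singleton]) auto
    then show ?thesis by (simp add: vimage_def)
  qed
  have "{\<xi>. walks xs \<xi> k (Suc t) = z} =
      (\<Union>y\<in>UNIV. {\<xi>. walks xs \<xi> k t = y} \<inter> {\<xi>. \<xi> (k, t) = z - y})"
    by (auto simp: walks_def algebra_simps)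
  then show ?case
    using Suc.IH step countable_lattice by (auto intro!: sets.countable_UN' sets.Int)
qed

lemma mem_settle_iff:
  "z \<in> settle s C \<longleftrightarrow> z \<in> C \<or> (\<exists>t. s t = z \<and> s t \<notin> C \<and> (\<forall>u<t. s u \<in> C))"
proof (cases "\<exists>t. s t \<notin> C")
  case True
  define T where "T = (LEAST t. s t \<notin> C)"
  have T: "s T \<notin> C" "\<And>u. u < T \<Longrightarrow> s u \<in> C"
    using LeastI_ex[OF True] not_less_Least unfolding T_def by blast+
  have "t = T" if "s t \<notin> C" "\<forall>u<t. s u \<in> C" for t
    using that T by (metis nat_neq_iff)
  then show ?thesis
    using True T unfolding settle_def T_def[symmetric] by (metis insert_iff)
qed (auto simp: settle_def)

text \<open>Events about the cluster are measurable, so their probabilities are not junk values.\<close>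

lemma sets_idla:
  fixes xs :: "(int ^ 'd) list"
  shows "{\<xi>. z \<in> idla (walks xs \<xi>) k} \<in> sets walk_steps"
proof (induction k arbitrary: z)
  case (Suc k)
  let ?M = "walk_steps :: (nat \<times> nat \<Rightarrow> int ^ 'd) measure"
  define In where "In u = {\<xi>. walks xs \<xi> k u \<in> idla (walks xs \<xi>) k}" for u
  have "In u = (\<Union>y\<in>UNIV. {\<xi>. walks xs \<xi> k u = y} \<inter> {\<xi>. y \<in> idla (walks xs \<xi>) k})" for u
    by (auto simp: In_def)
  then have In: "In u \<in> sets ?M" for u
    using Suc.IH sets_walks countable_lattice by (auto intro!: sets.countable_UN' sets.Int)
  have fin: "(\<Inter>u\<in>{..<t}. In u) \<in> sets ?M" for t
    using In sets.top[of ?M] by (cases "t = 0") (auto intro!: sets.finite_INT)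
  have "{\<xi>. z \<in> idla (walks xs \<xi>) (Suc k)} = {\<xi>. z \<in> idla (walks xs \<xi>) k} \<union>
      (\<Union>t. ({\<xi>. walks xs \<xi> k t = z} - In t) \<inter> (\<Inter>u\<in>{..<t}. In u))"
    by (auto simp: mem_settle_iff In_def)
  moreover have "\<dots> \<in> sets ?M"
  proof (intro sets.Un sets.countable_UN image_subsetI sets.Int sets.Diff)
  qed (use Suc.IH sets_walks In fin in blast)+
  ultimately show ?case by simp
qed simp

lemma sets_not_covered:
  "{\<xi>. \<not> B \<subseteq> idla_cluster xs \<xi>} \<in> sets walk_steps"
proof -
  have "{\<xi>. \<not> B \<subseteq> idla_cluster xs \<xi>} =
      (\<Union>z\<in>B. space walk_steps - {\<xi>. z \<in> idla (walks xs \<xi>) (length xs)})"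
    by (auto simp: idla_cluster_def)
  moreover have "\<dots> \<in> sets walk_steps"
  proof (rule sets.countable_UN')
    show "countable B"
      using countable_lattice countable_subset by blast
  qed (use sets_idla in blast)
  ultimately show ?thesis by simp
qed

end

theory Submission
  imports Defs
begin

text \<open>
  Fix a site \<open>z\<close> of the ball and suppose that \<open>h\<close> takes values in the unit interval, has finite
  support and satisfies \<open>h y \<le> average of h over the neighbours of y\<close> for all \<open>y \<noteq> z\<close>. As long as \<open>z\<close>
  is not covered, an explorer started at \<open>x\<close> moves inside a finite set that does not contain \<open>z\<close>
  until it settles, so \<open>h\<close> along its path is a submartingale and the expectation of \<open>h\<close> at
  the site where it settles is at least \<open>h x\<close>. Settling at \<open>y\<close> uses up the amount \<open>h y\<close> of a finite
  stock \<open>\<Sum>y. h y\<close>. Explorers starting with \<open>\<Sum>x\<leftarrow>xs. h x\<close> much larger than the stock therefore cannot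
  all avoid \<open>z\<close>, except with exponentially small probability. Quantitatively,
  the weight \<open>exp (- \<Sum>y\<in>C. h y)\<close> of the current cluster \<open>C\<close>, set to 0 once \<open>z \<in> C\<close>, decreases
  in expectation by a factor \<open>1 - h x / 2\<close> with every explorer (lemma \<open>expectation_weight_Suc\<close>),
  and hence \<open>z\<close> is left uncovered with probability at most
  \<open>exp ((\<Sum>y. h y) - (\<Sum>x\<leftarrow>xs. h x) / 2)\<close> (lemma \<open>prob_uncovered_le\<close>). Only subharmonicity of
  \<open>h\<close> is used, so an explicit function replaces the Green function, and no hitting probability has
  to be estimated.

  The function \<open>h\<close> is a translate of \<open>potential S\<close>, normalised by its value at the origin: away from
  the origin it is the positive part of a slightly shifted multiple of \<open>|y|\<^sup>2\<^sup>-\<^sup>d\<close> (or \<open>- 2 ln |y|\<close> for \<open>d = 2\<close>)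
  minus a constant that makes it vanish at distance about \<open>2 R\<close> from the origin, where \<open>S = 4 R\<^sup>2\<close>.
  Before normalisation its sum over the lattice is at most a constant times \<open>R\<^sup>2\<close> (lemma
  \<open>sum_potential_le\<close>), its value at each starting point is at least a constant times
  \<open>R\<^sup>2 / R\<^sup>d\<close>, and its value at the origin is bounded for \<open>d \<ge> 3\<close> and of order \<open>ln R\<close> for \<open>d = 2\<close>
  (lemma \<open>potential_origin_le\<close>). With \<open>A R\<^sup>d\<close> explorers and \<open>A\<close> large, the starting total
  of order \<open>A R\<^sup>2\<close> beats the stock of order \<open>R\<^sup>2\<close>; the quotient by the value at the origin is the exponent of the
  theorem. A union bound over the at most \<open>(3 R)\<^sup>d\<close> sites of the ball finishes the proof.
\<close>

section \<open>Unit steps and the squared norm\<close>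

definition sqnorm :: "int ^ 'd \<Rightarrow> real" where
  "sqnorm y = (\<Sum>i\<in>UNIV. (real_of_int (y $ i))\<^sup>2)"

lemma sum_unit_steps:
  fixes f :: "int ^ 'd \<Rightarrow> 'b :: comm_monoid_add"
  shows "(\<Sum>e\<in>unit_steps. f e) = (\<Sum>i\<in>UNIV. f (axis i 1) + f (axis i (- 1)))"
proof -
  have eq: "unit_steps = (\<lambda>(i, c). axis i c :: int ^ 'd) ` (UNIV \<times> {- 1, 1})"
    by (auto simp: unit_steps_def)
  have inj: "inj_on (\<lambda>(i, c). axis i c :: int ^ 'd) (UNIV \<times> {- 1, 1})"
    by (auto simp: inj_on_def axis_eq_axis)
  have "(\<Sum>e\<in>unit_steps. f e) = (\<Sum>(i, c)\<in>UNIV \<times> {- 1, 1}. f (axis i c))"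
    unfolding eq sum.reindex[OF inj] by (simp add: case_prod_unfold)
  then show ?thesis
    by (simp add: sum.cartesian_product[symmetric] add.commute)
qed

lemma card_unit_steps: "card (unit_steps :: (int ^ 'd) set) = 2 * CARD('d)"
  using sum_unit_steps[of "\<lambda>_ :: int ^ 'd. 1 :: nat"] by simp

lemma sqnorm_step:
  "sqnorm (y + axis i c) = sqnorm y + 2 * of_int c * of_int (y $ i) + (of_int c)\<^sup>2"
proof -
  have "sqnorm (y + axis i c) =
      (\<Sum>j\<in>UNIV. (real_of_int (y $ j))\<^sup>2 + (if j = i then 2 * of_int c * of_int (y $ i) + (of_int c)\<^sup>2 else 0))"
    unfolding sqnorm_def by (intro sum.cong) (auto simp: axis_def power2_eq_square algebra_simps)
  then show ?thesis
    by (simp add: sum.distrib sqnorm_def)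
qed

text \<open>
  The squared norm grows by 1 on average in each step; this is what forces a walk out of a finite
  set in \<open>explorer_exits\<close>.
\<close>

lemma sum_sqnorm_steps:
  "(\<Sum>e\<in>unit_steps. sqnorm (y + e)) = card (unit_steps :: (int ^ 'd) set) * (sqnorm (y :: int ^ 'd) + 1)"
  by (simp add: sum_unit_steps card_unit_steps sqnorm_step algebra_simps)

section \<open>Explorers stopped on leaving the cluster\<close>

lemma AE_walk_steps_unit:
  "AE \<xi> in (walk_steps :: (nat \<times> nat \<Rightarrow> int ^ 'd) measure). \<forall>i. \<xi> i \<in> unit_steps"
proof (subst AE_all_countable, intro allI)
  fix i :: "nat \<times> nat"
  have "AE e in measure_pmf (pmf_of_set (unit_steps :: (int ^ 'd) set)). e \<in> unit_steps"
    by (simp add: AE_measure_pmf_iff finite_unit_steps unit_steps_nonempty)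
  then show "AE \<xi> in (walk_steps :: (nat \<times> nat \<Rightarrow> int ^ 'd) measure). \<xi> i \<in> unit_steps"
    unfolding walk_steps_def
    by (intro AE_PiM_component) (auto intro: prob_space_measure_pmf)
qed

text \<open>
  The only form in which the independence of the steps enters: redrawing one step does not change
  the law of the whole family. For a fixed index \<open>i\<close> this is a one-step Markov property as soon as \<open>Z\<close>
  depends on step \<open>i\<close> in a known way.
\<close>

lemma integral_resample_step:
  fixes Z :: "(nat \<times> nat \<Rightarrow> int ^ 'd) \<Rightarrow> real"
  assumes Z: "integrable walk_steps Z"
  shows "(\<integral>\<xi>. Z \<xi> \<partial>walk_steps) =
    (\<integral>\<xi>. (\<Sum>e\<in>unit_steps. Z (\<xi>(i := e))) / card (unit_steps :: (int ^ 'd) set) \<partial>walk_steps)"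
proof -
  let ?U = "unit_steps :: (int ^ 'd) set"
  let ?M = "walk_steps :: (nat \<times> nat \<Rightarrow> int ^ 'd) measure"
  let ?P = "measure_pmf (pmf_of_set ?U)"
  let ?f = "\<lambda>(e :: int ^ 'd, \<xi> :: nat \<times> nat \<Rightarrow> int ^ 'd). \<xi>(i := e)"
  interpret W: prob_space ?M by (rule prob_space_walk_steps)
  interpret P: prob_space ?P by (rule prob_space_measure_pmf)
  interpret pair_sigma_finite ?P ?M ..
  \<comment> \<open>Inserting a coordinate into a product over the full index set overwrites that coordinate.\<close>
  have distr: "distr (?P \<Otimes>\<^sub>M ?M) ?M ?f = ?M"
    using distr_pair_PiM_eq_PiM[of UNIV "\<lambda>_. ?P" i]
    by (simp add: prob_space_measure_pmf walk_steps_def)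
  have meas: "?f \<in> measurable (?P \<Otimes>\<^sub>M ?M) ?M"
    unfolding walk_steps_def case_prod_unfold
    by (rule measurable_fun_upd[where J = UNIV]) auto
  have int: "integrable (?P \<Otimes>\<^sub>M ?M) (\<lambda>p. Z (?f p))"
    using Z distr meas by (metis integrable_distr)
  have "(\<integral>\<xi>. Z \<xi> \<partial>?M) = (\<integral>p. Z (?f p) \<partial>(?P \<Otimes>\<^sub>M ?M))"
    using Z meas by (subst distr[symmetric], subst integral_distr) auto
  also have "\<dots> = (\<integral>\<xi>. \<integral>e. Z (\<xi>(i := e)) \<partial>?P \<partial>?M)"
    using integral_snd[of "\<lambda>e \<xi>. Z (\<xi>(i := e))"] int by (simp add: case_prod_unfold)
  finally show ?thesis
    by (simp add: integral_pmf_of_set finite_unit_steps unit_steps_nonempty)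
qed

text \<open>
  The trajectory frozen at its first exit from \<open>C\<close>, written as a recursion in time so that its next
  value depends on the past only through its present one.
\<close>

primrec stopped :: "'a set \<Rightarrow> (nat \<Rightarrow> 'a) \<Rightarrow> nat \<Rightarrow> 'a" where
  "stopped C s 0 = s 0"
| "stopped C s (Suc t) = (if stopped C s t \<in> C then s (Suc t) else stopped C s t)"

lemma stopped_in_cluster:
  "stopped C s t \<in> C \<Longrightarrow> stopped C s t = s t \<and> (\<forall>u\<le>t. s u \<in> C)"
  by (induction t) (auto simp: le_Suc_eq split: if_splits)

lemma stopped_outside_cluster:
  "stopped C s t \<notin> C \<Longrightarrow> \<exists>u. stopped C s t = s u \<and> (\<forall>v<u. s v \<in> C)"
proof (induction t)
  case (Suc t)
  show ?case
  proof (cases "stopped C s t \<in> C")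
    case True
    then show ?thesis
      using stopped_in_cluster[OF True] by (intro exI[of _ "Suc t"]) (auto simp: less_Suc_eq_le)
  qed (use Suc in auto)
qed auto

lemma settle_stopped:
  assumes "stopped C s t \<notin> C"
  shows "settle s C = insert (stopped C s t) C"
proof -
  obtain u where u: "stopped C s t = s u" "\<forall>v<u. s v \<in> C"
    using stopped_outside_cluster[OF assms] by blast
  then have "(LEAST t. s t \<notin> C) = u"
    using assms by (intro Least_equality) (auto simp: not_less[symmetric])
  then show ?thesis
    using assms u by (auto simp: settle_def)
qed

lemma settle_cases:
  "settle s C = C \<or> (\<exists>t. stopped C s t \<notin> C \<and> settle s C = insert (stopped C s t) C)"
proof (cases "\<exists>t. stopped C s t \<notin> C")
  case False
  then have "\<forall>t. s t \<in> C"
    using stopped_in_cluster by fastforce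
  then show ?thesis
    by (simp add: settle_def)
qed (use settle_stopped in fast)

lemma finite_idla: "finite (idla S k)"
  by (induction k) (auto simp: settle_def)

lemma stopped_cong:
  "(\<And>u. u \<le> t \<Longrightarrow> s u = s' u) \<Longrightarrow> stopped C s t = stopped C s' t"
  by (induction t) auto

lemma idla_cong:
  "(\<And>j. j < k \<Longrightarrow> S j = S' j) \<Longrightarrow> idla S k = idla S' k"
  by (induction k) auto

abbreviation cluster :: "(int ^ 'd) list \<Rightarrow> nat \<Rightarrow> (nat \<times> nat \<Rightarrow> int ^ 'd) \<Rightarrow> (int ^ 'd) set" where
  "cluster xs k \<xi> \<equiv> idla (walks xs \<xi>) k"

abbreviation explorer :: "(int ^ 'd) list \<Rightarrow> nat \<Rightarrow> nat \<Rightarrow> (nat \<times> nat \<Rightarrow> int ^ 'd) \<Rightarrow> int ^ 'd" where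
  "explorer xs k t \<xi> \<equiv> stopped (cluster xs k \<xi>) (walks xs \<xi> k) t"

lemma cluster_resample: "cluster xs k (\<xi>((k, t) := e)) = cluster xs k \<xi>"
  by (rule idla_cong) (auto simp: walks_def)

text \<open>
  Explorer \<open>k\<close> at time \<open>Suc t\<close> sees step \<open>(k, t)\<close> only as its last move, whereas cluster \<open>k\<close> is built
  from walks with smaller indices and does not see it at all.
\<close>

lemma explorer_resample:
  "explorer xs k (Suc t) (\<xi>((k, t) := e)) =
    (if explorer xs k t \<xi> \<in> cluster xs k \<xi> then explorer xs k t \<xi> + e else explorer xs k t \<xi>)"
proof -
  have "explorer xs k t (\<xi>((k, t) := e)) = explorer xs k t \<xi>"
    unfolding cluster_resample by (rule stopped_cong) (auto simp: walks_def)
  moreover have "walks xs (\<xi>((k, t) := e)) k (Suc t) = walks xs \<xi> k t + e"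
    by (simp add: walks_def)
  ultimately show ?thesis
    using stopped_in_cluster[of "cluster xs k \<xi>" "walks xs \<xi> k" t]
    by (auto simp: cluster_resample)
qed

text \<open>
  A deterministic finite region that almost surely contains the first \<open>k\<close> settled sites. It makes
  every function of cluster and explorer bounded and so integrable.
\<close>

primrec reach :: "(int ^ 'd) list \<Rightarrow> nat \<Rightarrow> (int ^ 'd) set" where
  "reach xs 0 = {}"
| "reach xs (Suc k) = insert (xs ! k) (reach xs k \<union> (\<lambda>(y, e). y + e) ` (reach xs k \<times> unit_steps))"

lemma finite_reach: "finite (reach xs k)"
  by (induction k) (auto simp: finite_unit_steps)

lemma explorer_in_reach:
  assumes unit: "\<forall>i. \<xi> i \<in> unit_steps" and "cluster xs k \<xi> \<subseteq> reach xs k"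
  shows "explorer xs k t \<xi> \<in> reach xs (Suc k)"
proof (induction t)
  case (Suc t)
  show ?case
  proof (cases "explorer xs k t \<xi> \<in> cluster xs k \<xi>")
    case True
    then have "explorer xs k (Suc t) \<xi> = explorer xs k t \<xi> + \<xi> (k, t)"
      using stopped_in_cluster[OF True] by (simp add: walks_def)
    moreover have "explorer xs k t \<xi> \<in> reach xs k"
      using True assms by blast
    ultimately show ?thesis
      using unit by force
  qed (use Suc in auto)
qed (simp add: walks_def)

lemma cluster_in_reach:
  assumes "\<forall>i. \<xi> i \<in> unit_steps"
  shows "cluster xs k \<xi> \<subseteq> reach xs k"
proof (induction k)
  case (Suc k)
  have "cluster xs k \<xi> \<subseteq> reach xs (Suc k)"
    using Suc by auto
  then show ?case
    using settle_cases[of "walks xs \<xi> k" "cluster xs k \<xi>"] explorer_in_reach[OF assms Suc]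
    by (auto simp del: reach.simps)
qed simp

lemma measurable_cluster:
  "(\<lambda>\<xi>. cluster xs k \<xi>) \<in> measurable walk_steps (count_space {C. finite C})"
proof (rule measurable_count_space_eq_countable[THEN iffD2])
  show "countable {C :: (int ^ 'd) set. finite C}"
    by (rule countable_Collect_finite)
  have "{\<xi>. cluster xs k \<xi> = C} \<in> sets walk_steps" for C
  proof -
    have "{\<xi> \<in> space walk_steps. z \<in> cluster xs k \<xi> \<longleftrightarrow> z \<in> C} \<in> sets walk_steps" for z
      using sets_idla[of z xs k] sets.compl_sets[OF sets_idla[of z xs k]]
      by (cases "z \<in> C") (auto simp: Compl_eq_Diff_UNIV[symmetric] Collect_neg_eq)
    then have "{\<xi> \<in> space walk_steps. \<forall>z. z \<in> cluster xs k \<xi> \<longleftrightarrow> z \<in> C} \<in> sets walk_steps"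
      by (rule sets.sets_Collect_countable_All)
    then show ?thesis
      by (simp add: set_eq_iff)
  qed
  then show "(\<lambda>\<xi>. cluster xs k \<xi>) \<in> space walk_steps \<rightarrow> {C. finite C} \<and>
    (\<forall>C\<in>{C. finite C}. (\<lambda>\<xi>. cluster xs k \<xi>) -` {C} \<inter> space walk_steps \<in> sets walk_steps)"
    by (auto simp: finite_idla vimage_def)
qed

lemma measurable_explorer:
  fixes xs :: "(int ^ 'd) list"
  shows "(\<lambda>\<xi>. explorer xs k t \<xi>) \<in> measurable walk_steps (count_space UNIV)"
proof (rule measurable_count_space_eq_countable[THEN iffD2])
  show "countable (UNIV :: (int ^ 'd) set)"
    by (rule countable_lattice)
  have "{\<xi>. explorer xs k t \<xi> = y} \<in> sets walk_steps" for y
  proof (induction t arbitrary: y)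
    case 0
    show ?case
      using sets_walks[of xs k 0 y] by simp
  next
    case (Suc t)
    have "{\<xi>. explorer xs k (Suc t) \<xi> = y} =
      (\<Union>x\<in>UNIV. {\<xi>. explorer xs k t \<xi> = x} \<inter>
        ({\<xi>. x \<in> cluster xs k \<xi>} \<inter> {\<xi>. walks xs \<xi> k (Suc t) = y} \<union>
         ({\<xi>. explorer xs k t \<xi> = y} - {\<xi>. x \<in> cluster xs k \<xi>})))"
      by auto
    then show ?case
      using Suc.IH sets_walks sets_idla countable_lattice
      by (auto intro!: sets.countable_UN' sets.Int sets.Un sets.Diff)
  qed
  then show "(\<lambda>\<xi>. explorer xs k t \<xi>) \<in> space walk_steps \<rightarrow> UNIV \<and>
    (\<forall>y\<in>UNIV. (\<lambda>\<xi>. explorer xs k t \<xi>) -` {y} \<inter> space walk_steps \<in> sets walk_steps)"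
    by (auto simp: vimage_def)
qed

lemma integrable_state:
  fixes G :: "(int ^ 'd) set \<Rightarrow> int ^ 'd \<Rightarrow> real" and xs :: "(int ^ 'd) list"
  shows "integrable walk_steps (\<lambda>\<xi>. G (cluster xs k \<xi>) (explorer xs k t \<xi>))"
proof -
  let ?M = "walk_steps :: (nat \<times> nat \<Rightarrow> int ^ 'd) measure"
  let ?S = "Pow (reach xs k) \<times> reach xs (Suc k)"
  let ?B = "Max ((\<lambda>(C, y). \<bar>G C y\<bar>) ` ?S)"
  interpret prob_space ?M by (rule prob_space_walk_steps)
  have "(\<lambda>\<xi>. (cluster xs k \<xi>, explorer xs k t \<xi>)) \<in>
      measurable ?M (count_space {C. finite C} \<Otimes>\<^sub>M count_space UNIV)"
    by (intro measurable_Pair measurable_cluster measurable_explorer)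
  also have "count_space {C :: (int ^ 'd) set. finite C} \<Otimes>\<^sub>M count_space (UNIV :: (int ^ 'd) set)
      = count_space ({C. finite C} \<times> UNIV)"
    by (intro pair_measure_countable countable_Collect_finite countable_lattice)
  finally have state: "(\<lambda>\<xi>. (cluster xs k \<xi>, explorer xs k t \<xi>)) \<in>
      measurable ?M (count_space ({C. finite C} \<times> UNIV))" .
  have "(\<lambda>\<xi>. case (cluster xs k \<xi>, explorer xs k t \<xi>) of (C, y) \<Rightarrow> G C y) \<in> borel_measurable ?M"
    by (rule measurable_compose[OF state]) simp
  moreover have "AE \<xi> in ?M. norm (G (cluster xs k \<xi>) (explorer xs k t \<xi>)) \<le> ?B"
    using AE_walk_steps_unit
  proof eventually_elim
    case (elim \<xi>)
    then have "(cluster xs k \<xi>, explorer xs k t \<xi>) \<in> ?S"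
      using cluster_in_reach[OF elim] explorer_in_reach[OF elim] by blast
    moreover have "finite ?S"
      by (intro finite_cartesian_product finite_Pow_iff[THEN iffD2] finite_reach)
    ultimately show ?case
      by (intro Max_ge) (auto simp del: reach.simps intro!: rev_image_eqI)
  qed
  ultimately show ?thesis
    by (intro integrable_const_bound) simp_all
qed

text \<open>
  Conditional on the past, the explorer takes a uniform step while it is inside the cluster and
  rests otherwise.
\<close>

lemma expectation_state_step:
  fixes G :: "(int ^ 'd) set \<Rightarrow> int ^ 'd \<Rightarrow> real" and xs :: "(int ^ 'd) list"
  shows "(\<integral>\<xi>. G (cluster xs k \<xi>) (explorer xs k (Suc t) \<xi>) \<partial>walk_steps) =
    (\<integral>\<xi>. (if explorer xs k t \<xi> \<in> cluster xs k \<xi>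
         then (\<Sum>e\<in>unit_steps. G (cluster xs k \<xi>) (explorer xs k t \<xi> + e)) / card (unit_steps :: (int ^ 'd) set)
         else G (cluster xs k \<xi>) (explorer xs k t \<xi>)) \<partial>walk_steps)"
proof -
  have "card (unit_steps :: (int ^ 'd) set) \<noteq> 0"
    by (simp add: finite_unit_steps unit_steps_nonempty)
  then show ?thesis
    by (subst integral_resample_step[OF integrable_state, of _ _ _ _ "(k, t)"],
        intro Bochner_Integration.integral_cong refl)
      (simp add: cluster_resample explorer_resample[unfolded cluster_resample] del: stopped.simps)
qed

section \<open>The probability that a site stays uncovered\<close>

text \<open>
  The expected squared norm of the stopped explorer increases by the probability of still being
  inside the cluster, and it stays bounded. The probabilities are therefore summable.
\<close>

lemma explorer_exits:
  fixes xs :: "(int ^ 'd) list"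
  shows "(\<lambda>t. \<integral>\<xi>. of_bool (explorer xs k t \<xi> \<in> cluster xs k \<xi>) \<partial>walk_steps) \<longlonglongrightarrow> (0 :: real)"
proof -
  let ?M = "walk_steps :: (nat \<times> nat \<Rightarrow> int ^ 'd) measure"
  let ?p = "\<lambda>t. \<integral>\<xi>. of_bool (explorer xs k t \<xi> \<in> cluster xs k \<xi>) \<partial>?M :: real"
  let ?q = "\<lambda>t. \<integral>\<xi>. sqnorm (explorer xs k t \<xi>) \<partial>?M"
  let ?B = "Max (sqnorm ` reach xs (Suc k))"
  interpret prob_space ?M by (rule prob_space_walk_steps)
  have "?q (Suc t) = ?q t + ?p t" for t
  proof -
    have "card (unit_steps :: (int ^ 'd) set) \<noteq> 0"
      by (simp add: finite_unit_steps unit_steps_nonempty)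
    then have "?q (Suc t) = (\<integral>\<xi>. sqnorm (explorer xs k t \<xi>) + of_bool (explorer xs k t \<xi> \<in> cluster xs k \<xi>) \<partial>?M)"
      by (subst expectation_state_step[of "\<lambda>_ y. sqnorm y"])
        (auto simp: sum_sqnorm_steps intro!: Bochner_Integration.integral_cong)
    also have "\<dots> = ?q t + ?p t"
      by (rule Bochner_Integration.integral_add)
        (rule integrable_state[where G = "\<lambda>_ y. sqnorm y"],
         rule integrable_state[where G = "\<lambda>C y. of_bool (y \<in> C)"])
    finally show ?thesis .
  qed
  then have telescope: "?q 0 + (\<Sum>s<t. ?p s) = ?q t" for t
    by (induction t) (simp_all del: stopped.simps)
  have bound: "?q t \<le> ?B" for t
  proof (rule integral_le_const[OF integrable_state[where G = "\<lambda>_ y. sqnorm y"]])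
    show "AE \<xi> in ?M. sqnorm (explorer xs k t \<xi>) \<le> ?B"
      using AE_walk_steps_unit
    proof eventually_elim
      case (elim \<xi>)
      then show ?case
        using explorer_in_reach[OF elim cluster_in_reach[OF elim]] finite_reach
        by (intro Max_ge finite_imageI imageI)
    qed
  qed
  have "summable ?p"
  proof (rule summableI_nonneg_bounded)
    show "(\<Sum>s<t. ?p s) \<le> ?B - ?q 0" for t
      using telescope[of t] bound[of t] by linarith
  qed simp
  then show ?thesis
    by (rule summable_LIMSEQ_zero)
qed

text \<open>
  The supermartingale of the argument. It vanishes on clusters that contain \<open>z\<close>, the
  only site at which \<open>h\<close> may fail to be subharmonic.
\<close>

definition weight :: "('a \<Rightarrow> real) \<Rightarrow> 'a \<Rightarrow> 'a set \<Rightarrow> real" where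
  "weight h z C = (if z \<in> C then 0 else exp (- (\<Sum>y\<in>C. h y)))"

context
  fixes h :: "int ^ 'd \<Rightarrow> real" and z :: "int ^ 'd"
  assumes h_nonneg: "\<And>y. 0 \<le> h y" and h_le_1: "\<And>y. h y \<le> 1"
    and subharmonic: "\<And>y. y \<noteq> z \<Longrightarrow> card (unit_steps :: (int ^ 'd) set) * h y \<le> (\<Sum>e\<in>unit_steps. h (y + e))"
begin

text \<open>
  Submartingale property of \<open>h\<close> along the stopped explorer, weighted by a function of the cluster
  which the explorer moves in.
\<close>

lemma expectation_explorer_potential:
  "h (xs ! k) * (\<integral>\<xi>. weight h z (cluster xs k \<xi>) \<partial>walk_steps) \<le>
   (\<integral>\<xi>. weight h z (cluster xs k \<xi>) * h (explorer xs k t \<xi>) \<partial>walk_steps)"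
proof (induction t)
  case 0
  show ?case by (simp add: walks_def mult.commute)
next
  case (Suc t)
  let ?c = "real (card (unit_steps :: (int ^ 'd) set))"
  have c: "?c > 0"
    by (simp add: finite_unit_steps unit_steps_nonempty card_gt_0_iff)
  have le: "weight h z C * h y \<le> (if y \<in> C then (\<Sum>e\<in>unit_steps. weight h z C * h (y + e)) / ?c else weight h z C * h y)" for C y
  proof (cases "y \<in> C \<and> z \<notin> C")
    case True
    then have "h y \<le> (\<Sum>e\<in>unit_steps. h (y + e)) / ?c"
      using subharmonic[of y] c by (auto simp: field_simps)
    then have "weight h z C * h y \<le> weight h z C * ((\<Sum>e\<in>unit_steps. h (y + e)) / ?c)"
      by (intro mult_left_mono) (auto simp: weight_def)
    then show ?thesis
      using True by (simp add: sum_distrib_left)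
  qed (auto simp: weight_def)
  have "(\<integral>\<xi>. weight h z (cluster xs k \<xi>) * h (explorer xs k t \<xi>) \<partial>walk_steps) \<le>
     (\<integral>\<xi>. weight h z (cluster xs k \<xi>) * h (explorer xs k (Suc t) \<xi>) \<partial>walk_steps)"
    unfolding expectation_state_step[of "\<lambda>C y. weight h z C * h y"]
    by (intro integral_mono le integrable_state[where G = "\<lambda>C y. weight h z C * h y"]
       integrable_state[where G = "\<lambda>C y. if y \<in> C then (\<Sum>e\<in>unit_steps. weight h z C * h (y + e)) / ?c else weight h z C * h y"])
  with Suc show ?case by linarith
qed

text \<open>
  The explorer settles at \<open>y\<close>, the point where it is stopped, which multiplies the weight by
  \<open>exp (- h y)\<close>, or by 0 if \<open>y = z\<close>. The last summand
  pays for the event that it has not left \<open>C\<close> by time \<open>t\<close>.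
\<close>

lemma weight_settle_le:
  assumes "finite C"
  shows "weight h z (settle s C) \<le>
    weight h z C - weight h z C * h (stopped C s t) / 2 + of_bool (stopped C s t \<in> C)"
proof (cases "stopped C s t \<in> C")
  case True
  have w: "weight h z C \<le> 1" "0 \<le> weight h z C"
    using sum_nonneg[of C h] h_nonneg by (simp_all add: weight_def)
  have "weight h z (settle s C) \<le> weight h z C"
    using settle_cases[of s C]
  proof (elim disjE exE conjE)
    fix t assume "stopped C s t \<notin> C" "settle s C = insert (stopped C s t) C"
    then show ?thesis
      using assms h_nonneg[of "stopped C s t"] by (simp add: weight_def)
  qed simp
  moreover have "weight h z C * h (stopped C s t) \<le> 1 * 1"
    by (intro mult_mono w h_le_1 h_nonneg) simp
  ultimately show ?thesis
    using True by simp
next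
  case False
  define y where "y = stopped C s t"
  have eq: "settle s C = insert y C" and y: "y \<notin> C"
    using False settle_stopped[OF False] by (simp_all add: y_def)
  \<comment> \<open>On the unit interval \<open>exp (- u) \<le> 1 / (1 + u) \<le> 1 - u / 2\<close>; this is where \<open>h \<le> 1\<close> enters.\<close>
  have "exp (- h y) \<le> 1 / (1 + h y)"
    using exp_ge_add_one_self[of "h y"] h_nonneg[of y] by (simp add: exp_minus field_simps)
  also have "\<dots> \<le> 1 - h y / 2"
    using h_nonneg[of y] h_le_1[of y] mult_left_mono[OF h_le_1[of y] h_nonneg[of y]]
    by (simp add: field_simps)
  finally have "weight h z C * exp (- h y) \<le> weight h z C * (1 - h y / 2)"
    by (intro mult_left_mono) (auto simp: weight_def)
  moreover have "weight h z (insert y C) \<le> weight h z C * exp (- h y)"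
    using assms y by (auto simp: weight_def exp_add[symmetric])
  ultimately show ?thesis
    using False by (simp add: eq y_def[symmetric] algebra_simps)
qed

lemma expectation_weight_Suc:
  "(\<integral>\<xi>. weight h z (cluster xs (Suc k) \<xi>) \<partial>walk_steps) \<le>
   (1 - h (xs ! k) / 2) * (\<integral>\<xi>. weight h z (cluster xs k \<xi>) \<partial>walk_steps)"
proof -
  let ?E = "\<lambda>f. \<integral>\<xi>. f \<xi> \<partial>(walk_steps :: (nat \<times> nat \<Rightarrow> int ^ 'd) measure)"
  let ?W = "\<lambda>k. ?E (\<lambda>\<xi>. weight h z (cluster xs k \<xi>))"
  let ?p = "\<lambda>t. ?E (\<lambda>\<xi>. of_bool (explorer xs k t \<xi> \<in> cluster xs k \<xi>)) :: real"
  have W: "integrable walk_steps (\<lambda>\<xi>. weight h z (cluster xs k \<xi>))" for k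
    by (rule integrable_state[where G = "\<lambda>C _. weight h z C"])
  have Wh: "integrable walk_steps (\<lambda>\<xi>. weight h z (cluster xs k \<xi>) * h (explorer xs k t \<xi>))" for t
    by (rule integrable_state[where G = "\<lambda>C y. weight h z C * h y"])
  have p: "integrable walk_steps (\<lambda>\<xi>. of_bool (explorer xs k t \<xi> \<in> cluster xs k \<xi>) :: real)" for t
    by (rule integrable_state[where G = "\<lambda>C y. of_bool (y \<in> C)"])
  have "?W (Suc k) \<le> (1 - h (xs ! k) / 2) * ?W k + ?p t" for t
  proof -
    have "?W (Suc k) \<le> ?E (\<lambda>\<xi>. weight h z (cluster xs k \<xi>)
        - weight h z (cluster xs k \<xi>) * h (explorer xs k t \<xi>) / 2 + of_bool (explorer xs k t \<xi> \<in> cluster xs k \<xi>))"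
    proof (rule integral_mono)
      fix \<xi> show "weight h z (cluster xs (Suc k) \<xi>) \<le> weight h z (cluster xs k \<xi>)
        - weight h z (cluster xs k \<xi>) * h (explorer xs k t \<xi>) / 2 + of_bool (explorer xs k t \<xi> \<in> cluster xs k \<xi>)"
        using weight_settle_le[OF finite_idla] by simp
    qed (intro Bochner_Integration.integrable_add Bochner_Integration.integrable_diff
        Bochner_Integration.integrable_divide W Wh p)+
    also have "\<dots> = ?W k - ?E (\<lambda>\<xi>. weight h z (cluster xs k \<xi>) * h (explorer xs k t \<xi>)) / 2 + ?p t"
      using W Wh p by simp
    also have "\<dots> \<le> (1 - h (xs ! k) / 2) * ?W k + ?p t"
      using expectation_explorer_potential[of xs k t] by (simp add: algebra_simps)
    finally show ?thesis .
  qed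
  \<comment> \<open>The explorer leaves the cluster almost surely, so the error disappears as \<open>t\<close> grows.\<close>
  moreover have "(\<lambda>t. (1 - h (xs ! k) / 2) * ?W k + ?p t) \<longlonglongrightarrow> (1 - h (xs ! k) / 2) * ?W k + 0"
    by (intro tendsto_add tendsto_const explorer_exits)
  ultimately show ?thesis
    by (intro LIMSEQ_le_const[where X = "\<lambda>t. (1 - h (xs ! k) / 2) * ?W k + ?p t"]) auto
qed

lemma expectation_weight_le:
  "(\<integral>\<xi>. weight h z (cluster xs k \<xi>) \<partial>walk_steps) \<le> exp (- (\<Sum>j<k. h (xs ! j)) / 2)"
proof (induction k)
  case 0
  have "measure (walk_steps :: (nat \<times> nat \<Rightarrow> int ^ 'd) measure) UNIV = 1"
    using prob_space.prob_space[OF prob_space_walk_steps] by simp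
  then show ?case
    by (simp add: weight_def)
next
  case (Suc k)
  have "(\<integral>\<xi>. weight h z (cluster xs (Suc k) \<xi>) \<partial>walk_steps)
      \<le> (1 - h (xs ! k) / 2) * (\<integral>\<xi>. weight h z (cluster xs k \<xi>) \<partial>walk_steps)"
    by (rule expectation_weight_Suc)
  also have "\<dots> \<le> exp (- h (xs ! k) / 2) * exp (- (\<Sum>j<k. h (xs ! j)) / 2)"
    using exp_ge_add_one_self[of "- h (xs ! k) / 2"] Suc
    by (intro mult_mono) (auto simp: weight_def intro!: integral_nonneg_AE)
  also have "\<dots> = exp (- (\<Sum>j<Suc k. h (xs ! j)) / 2)"
    by (simp add: exp_add[symmetric] diff_divide_distrib add_divide_distrib)
  finally show ?case .
qed

text \<open>
  A cluster that misses \<open>z\<close> has weight at least \<open>exp (- \<Sum>y\<in>D. h y)\<close>, and the expected weight after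
  the last explorer is small: this is Markov's inequality.
\<close>

lemma prob_uncovered_le:
  assumes "finite D" and D: "\<And>y. y \<notin> D \<Longrightarrow> h y = 0"
  shows "\<P>(\<xi> in walk_steps. z \<notin> idla_cluster xs \<xi>)
    \<le> exp ((\<Sum>y\<in>D. h y) - (\<Sum>x\<leftarrow>xs. h x) / 2)"
proof -
  let ?M = "walk_steps :: (nat \<times> nat \<Rightarrow> int ^ 'd) measure"
  let ?N = "length xs"
  let ?U = "{\<xi>. z \<notin> cluster xs ?N \<xi>}"
  interpret prob_space ?M by (rule prob_space_walk_steps)
  have U: "?U \<in> sets ?M"
    using sets_not_covered[of "{z}" xs] by (simp add: idla_cluster_def)
  have sum_le: "sum h C \<le> sum h D" if "finite C" for C
  proof -
    have "sum h C = sum h (C \<inter> D)"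
      using that D by (intro sum.mono_neutral_right) auto
    also have "\<dots> \<le> sum h D"
      using assms(1) h_nonneg by (intro sum_mono2) auto
    finally show ?thesis .
  qed
  have "exp (- sum h D) * prob ?U = (\<integral>\<xi>. exp (- sum h D) * indicator ?U \<xi> \<partial>?M)"
    using U by simp
  also have "\<dots> \<le> (\<integral>\<xi>. weight h z (cluster xs ?N \<xi>) \<partial>?M)"
  proof (rule integral_mono)
    show "integrable ?M (\<lambda>\<xi>. weight h z (cluster xs ?N \<xi>))"
      by (rule integrable_state[where G = "\<lambda>C _. weight h z C"])
    show "integrable ?M (\<lambda>\<xi>. exp (- sum h D) * indicator ?U \<xi>)"
      using U by (intro integrable_mult_right integrable_real_indicator) (simp_all add: emeasure_eq_measure)
    show "exp (- sum h D) * indicator ?U \<xi> \<le> weight h z (cluster xs ?N \<xi>)" for \<xi>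
      using sum_le[OF finite_idla, of "walks xs \<xi>" ?N] by (auto simp: weight_def)
  qed
  also have "\<dots> \<le> exp (- (\<Sum>j<?N. h (xs ! j)) / 2)"
    by (rule expectation_weight_le)
  also have "(\<Sum>j<?N. h (xs ! j)) = (\<Sum>x\<leftarrow>xs. h x)"
    by (simp add: sum_list_sum_nth atLeast0LessThan)
  finally have "prob ?U \<le> exp (sum h D) * exp (- (\<Sum>x\<leftarrow>xs. h x) / 2)"
    by (simp add: exp_minus field_simps)
  then show ?thesis
    by (simp add: idla_cluster_def exp_add[symmetric])
qed

end

section \<open>The radial profile\<close>

text \<open>
  The antiderivative of \<open>- (T powr (- d / 2))\<close>. Up to a constant factor, \<open>radial d (|x|\<^sup>2)\<close> is
  the fundamental solution of the Laplacian on \<open>d\<close>-dimensional Euclidean space.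
\<close>

definition radial :: "nat \<Rightarrow> real \<Rightarrow> real" where
  "radial d T = (if d = 2 then - ln T else T powr (1 - d / 2) / (d / 2 - 1))"

lemma DERIV_radial:
  assumes "T > 0" "d \<ge> 2"
  shows "(radial d has_real_derivative - (T powr (- real d / 2))) (at T)"
proof (cases "d = 2")
  case True
  have "((\<lambda>T. - ln T) has_real_derivative - (T powr (- real d / 2))) (at T)"
    using assms True by (auto intro!: derivative_eq_intros simp: powr_minus field_simps)
  then show ?thesis
    using True by (simp add: radial_def[abs_def])
next
  case False
  then have "real d / 2 - 1 \<noteq> 0" by auto
  then have "((\<lambda>T. T powr (1 - d / 2) / (d / 2 - 1)) has_real_derivative - (T powr (- real d / 2))) (at T)"
    using assms by (auto intro!: derivative_eq_intros simp: divide_simps) (simp add: algebra_simps)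
  then show ?thesis
    using False by (simp add: radial_def[abs_def])
qed

lemma radial_antimono:
  assumes "0 < S" "S \<le> T" "d \<ge> 2"
  shows "radial d T \<le> radial d S"
proof (rule DERIV_nonpos_imp_nonincreasing[OF assms(2)])
  fix x assume "S \<le> x" "x \<le> T"
  then show "\<exists>y. (radial d has_real_derivative y) (at x) \<and> y \<le> 0"
    using DERIV_radial[of x d] assms by (intro exI conjI) auto
qed

lemma radial_diff_ge:
  assumes "0 < S" "S \<le> T" "d \<ge> 2"
  shows "(T - S) * T powr (- real d / 2) \<le> radial d S - radial d T"
proof -
  have "radial d T + T * T powr (- real d / 2) \<le> radial d S + S * T powr (- real d / 2)"
  proof (rule DERIV_nonpos_imp_nonincreasing[OF assms(2)])
    fix x assume x: "S \<le> x" "x \<le> T"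
    have "((\<lambda>x. radial d x + x * T powr (- real d / 2)) has_real_derivative
        - (x powr (- real d / 2)) + T powr (- real d / 2)) (at x)"
      using x assms by (auto intro!: derivative_eq_intros DERIV_radial)
    moreover have "T powr (- real d / 2) \<le> x powr (- real d / 2)"
      using x assms by (intro powr_mono2') auto
    ultimately show "\<exists>y. ((\<lambda>x. radial d x + x * T powr (- real d / 2)) has_real_derivative y) (at x) \<and> y \<le> 0"
      by (intro exI conjI) auto
  qed
  then show ?thesis by (simp add: algebra_simps)
qed

text \<open>
  Bounding the integral of \<open>s powr (- d / 2)\<close> over \<open>[S, T]\<close> by that of
  \<open>s powr (- 1 / 2) * S powr (1 / 2 - d / 2)\<close> avoids a separate treatment of the logarithm, and loses
  only a factor that is harmless when summed over the lattice.
\<close>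

lemma radial_diff_le:
  assumes "0 < S" "S \<le> T" "d \<ge> 2"
  shows "radial d S - radial d T \<le> 2 * sqrt T * S powr (1 / 2 - d / 2)"
proof -
  have "radial d S + 2 * sqrt S * S powr (1 / 2 - d / 2) \<le> radial d T + 2 * sqrt T * S powr (1 / 2 - d / 2)"
  proof (rule DERIV_nonneg_imp_nondecreasing[OF assms(2)])
    fix x assume x: "S \<le> x" "x \<le> T"
    have "((\<lambda>x. radial d x + 2 * sqrt x * S powr (1 / 2 - d / 2)) has_real_derivative
        - (x powr (- real d / 2)) + S powr (1 / 2 - d / 2) / sqrt x) (at x)"
      using x assms by (auto intro!: derivative_eq_intros DERIV_radial simp: field_simps)
    moreover have "x powr (- real d / 2) \<le> S powr (1 / 2 - d / 2) / sqrt x"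
    proof -
      have root: "x powr (1 / 2) = sqrt x"
        using x assms by (intro powr_half_sqrt) auto
      have "x powr (- real d / 2) = x powr (1 / 2 - d / 2) * x powr (- (1 / 2))"
        unfolding powr_add[symmetric] by (rule arg_cong[where f = "\<lambda>s. x powr s"]) argo
      also have "\<dots> = x powr (1 / 2 - d / 2) / sqrt x"
        unfolding powr_minus root by (rule divide_inverse[symmetric])
      also have "\<dots> \<le> S powr (1 / 2 - d / 2) / sqrt x"
        using x assms by (intro divide_right_mono powr_mono2') auto
      finally show ?thesis .
    qed
    ultimately show "\<exists>y. ((\<lambda>x. radial d x + 2 * sqrt x * S powr (1 / 2 - d / 2)) has_real_derivative y) (at x) \<and> 0 \<le> y"
      by (intro exI conjI) auto
  qed
  moreover have "0 \<le> 2 * sqrt S * S powr (1 / 2 - d / 2)"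
    using assms by simp
  ultimately show ?thesis by linarith
qed

text \<open>
  Taylor's formula of order 3. The fourth derivative is positive, so the remainder can be dropped
  for increments of either sign.
\<close>

lemma radial_taylor:
  assumes T: "T > 0" "T + a > 0" and d: "d \<ge> 2"
  defines "\<delta> \<equiv> real d / 2"
  shows "radial d (T + a) \<ge> radial d T - a * T powr (-\<delta>) + \<delta> * a\<^sup>2 / 2 * T powr (-\<delta> - 1)
    - \<delta> * (\<delta> + 1) * a ^ 3 / 6 * T powr (-\<delta> - 2)"
proof (cases "a = 0")
  case False
  define diff where "diff m x = (case m of 0 \<Rightarrow> radial d x | Suc 0 \<Rightarrow> - (x powr (-\<delta>))
    | Suc (Suc 0) \<Rightarrow> \<delta> * x powr (-\<delta> - 1)
    | Suc (Suc (Suc 0)) \<Rightarrow> - (\<delta> * (\<delta> + 1) * x powr (-\<delta> - 2))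
    | _ \<Rightarrow> \<delta> * (\<delta> + 1) * (\<delta> + 2) * x powr (-\<delta> - 3))" for m :: nat and x :: real
  have D: "\<forall>m x. m < 4 \<and> min T (T + a) \<le> x \<and> x \<le> max T (T + a) \<longrightarrow>
      (diff m has_real_derivative diff (Suc m) x) (at x)"
  proof (intro allI impI)
    fix m :: nat and x :: real
    assume m: "m < 4 \<and> min T (T + a) \<le> x \<and> x \<le> max T (T + a)"
    then have x: "x > 0" using T by auto
    from m have "m = 0 \<or> m = 1 \<or> m = 2 \<or> m = 3" by auto
    then show "(diff m has_real_derivative diff (Suc m) x) (at x)"
      using x DERIV_radial[OF x d]
      by (elim disjE; simp add: diff_def[abs_def] numeral_2_eq_2 numeral_3_eq_3 \<delta>_def)
        (auto intro!: derivative_eq_intros simp: field_simps)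
  qed
  have zero: "diff 0 = radial d" by (auto simp: diff_def)
  obtain t where t: "if T + a < T then T + a < t \<and> t < T else T < t \<and> t < T + a"
    and eq: "radial d (T + a) = (\<Sum>m<4. diff m T / fact m * (T + a - T) ^ m) + diff 4 t / fact 4 * (T + a - T) ^ 4"
    using Taylor[of 4 diff "radial d" "min T (T + a)" "max T (T + a)" T "T + a"] D False zero
    by (auto simp del: fact_numeral)
  have "0 \<le> diff 4 t"
    by (simp add: diff_def eval_nat_numeral \<delta>_def)
  then have "0 \<le> diff 4 t / fact 4 * (T + a - T) ^ 4"
    by simp
  moreover have "(\<Sum>m<4. diff m T / fact m * (T + a - T) ^ m) = radial d T - a * T powr (-\<delta>)
      + \<delta> * a\<^sup>2 / 2 * T powr (-\<delta> - 1) - \<delta> * (\<delta> + 1) * a ^ 3 / 6 * T powr (-\<delta> - 2)"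
    by (simp add: diff_def eval_nat_numeral mult_ac)
  ultimately show ?thesis
    unfolding eq by linarith
qed simp

lemma sqnorm_nonneg: "0 \<le> sqnorm y"
  by (simp add: sqnorm_def sum_nonneg)

lemma coord_sq_le_sqnorm: "(real_of_int (y $ i))\<^sup>2 \<le> sqnorm y"
  unfolding sqnorm_def by (rule member_le_sum) auto

text \<open>
  This keeps the arguments of \<open>radial\<close> at the neighbours of \<open>y\<close> positive, as the Taylor
  expansion requires.
\<close>

lemma radial_shifted_neighbours:
  fixes y :: "int ^ 'd"
  assumes d: "CARD('d) \<ge> 2" and far: "sqnorm y \<ge> 9 * CARD('d)"
  shows "1 \<le> sqnorm (y + axis i 1) - CARD('d)" "1 \<le> sqnorm (y + axis i (- 1)) - CARD('d)"
proof -
  define b where "b = real_of_int (y $ i)"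
  define T where "T = sqnorm y - CARD('d)"
  have T: "T \<ge> 8 * CARD('d)" "T \<ge> 16"
    using far d by (auto simp: T_def)
  have "(2 * b)\<^sup>2 \<le> 4 * T + 4 * CARD('d)"
    using coord_sq_le_sqnorm[of y i] by (simp add: T_def b_def power2_eq_square)
  also have "\<dots> \<le> 16 * T"
    using T by linarith
  also have "\<dots> \<le> T\<^sup>2"
    using T by (simp add: power2_eq_square)
  finally have "\<bar>2 * b\<bar> \<le> T"
    using T by (intro power2_le_imp_le[of "\<bar>2 * b\<bar>"]) auto
  then have "- T \<le> 2 * b" "2 * b \<le> T"
    by linarith+
  then show "1 \<le> sqnorm (y + axis i 1) - CARD('d)" "1 \<le> sqnorm (y + axis i (- 1)) - CARD('d)"
    by (simp_all add: sqnorm_step T_def b_def)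
qed

text \<open>
  For \<open>radial\<close> of the squared norm itself the third-order Taylor bound falls short of subharmonicity by
  a term of lower order; subtracting \<open>d\<close> from the squared norm repairs this. Write \<open>\<delta> = d / 2\<close> and \<open>T = |y|\<^sup>2 - d\<close> and sum the
  expansions at the neighbours. The terms of order \<open>T powr (- \<delta>)\<close> cancel since \<open>radial\<close>
  is harmonic in the continuum. At order \<open>T powr (- \<delta> - 1)\<close> the shift contributes
  enough to make the coefficient \<open>\<delta> * (6 * \<delta> - 4)\<close> positive, and this dominates the rest once \<open>T\<close> is at
  least of order \<open>\<delta>\<close>.
\<close>

lemma radial_subharmonic:
  fixes y :: "int ^ 'd"
  assumes d: "CARD('d) \<ge> 2" and far: "sqnorm y \<ge> 9 * CARD('d)"
  shows "card (unit_steps :: (int ^ 'd) set) * radial CARD('d) (sqnorm y - CARD('d))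
    \<le> (\<Sum>e\<in>unit_steps. radial CARD('d) (sqnorm (y + e) - CARD('d)))"
proof -
  define \<delta> where "\<delta> = real CARD('d) / 2"
  define T where "T = sqnorm y - CARD('d)"
  define Q where "Q = T powr (- \<delta> - 2)"
  let ?F = "radial CARD('d)"
  let ?b = "\<lambda>i. real_of_int (y $ i)"
  have \<delta>: "\<delta> \<ge> 1" and card: "real CARD('d) = 2 * \<delta>"
    using d by (auto simp: \<delta>_def)
  have T: "T \<ge> 16 * \<delta>" and q: "sqnorm y = T + 2 * \<delta>"
    using far card by (auto simp: T_def)
  have T0: "T > 0"
    using T \<delta> by linarith
  have Q: "T powr (- \<delta> - 1) = T * Q" "T powr (- \<delta>) = T\<^sup>2 * Q" "Q > 0"
    using T0 by (simp_all add: Q_def powr_diff power2_eq_square field_simps)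
  \<comment> \<open>Adding the expansions for the increments \<open>1 + 2 b\<close> and \<open>1 - 2 b\<close> removes the odd powers of \<open>b\<close>.\<close>
  have pair: "?F (sqnorm (y + axis i 1) - CARD('d)) + ?F (sqnorm (y + axis i (- 1)) - CARD('d))
      \<ge> 2 * ?F T - 2 * (T\<^sup>2 * Q) + \<delta> * (1 + 4 * (?b i)\<^sup>2) * (T * Q) - \<delta> * (\<delta> + 1) * (1 / 3 + 4 * (?b i)\<^sup>2) * Q"
    for i
  proof -
    have "?F (T + (1 + 2 * ?b i)) \<ge> ?F T - (1 + 2 * ?b i) * (T\<^sup>2 * Q) + \<delta> * (1 + 2 * ?b i)\<^sup>2 / 2 * (T * Q)
        - \<delta> * (\<delta> + 1) * (1 + 2 * ?b i) ^ 3 / 6 * Q"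
      using radial_taylor[of T "1 + 2 * ?b i" "CARD('d)"] radial_shifted_neighbours(1)[OF assms, of i] T0 d
      by (simp add: sqnorm_step T_def[symmetric] \<delta>_def[symmetric] Q Q_def[symmetric]) (simp add: T_def)
    moreover have "?F (T + (1 - 2 * ?b i)) \<ge> ?F T - (1 - 2 * ?b i) * (T\<^sup>2 * Q) + \<delta> * (1 - 2 * ?b i)\<^sup>2 / 2 * (T * Q)
        - \<delta> * (\<delta> + 1) * (1 - 2 * ?b i) ^ 3 / 6 * Q"
      using radial_taylor[of T "1 - 2 * ?b i" "CARD('d)"] radial_shifted_neighbours(2)[OF assms, of i] T0 d
      by (simp add: sqnorm_step T_def[symmetric] \<delta>_def[symmetric] Q Q_def[symmetric]) (simp add: T_def)
    moreover have "sqnorm (y + axis i 1) - CARD('d) = T + (1 + 2 * ?b i)"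
      "sqnorm (y + axis i (- 1)) - CARD('d) = T + (1 - 2 * ?b i)"
      by (simp_all add: sqnorm_step T_def)
    ultimately show ?thesis
      by (simp add: power2_eq_square power3_eq_cube) (simp add: field_simps)
  qed
  have "0 \<le> \<delta> * Q * ((6 * \<delta> - 4) * T - (\<delta> + 1) * (26 / 3) * \<delta>)"
  proof -
    have "(\<delta> + 1) * (26 / 3) * \<delta> \<le> (2 * \<delta>) * (26 / 3) * \<delta>"
      using \<delta> by (intro mult_right_mono) auto
    also have "\<dots> \<le> (2 * \<delta>) * (16 * \<delta>)"
      using \<delta> by simp
    also have "\<dots> \<le> (6 * \<delta> - 4) * T"
      using \<delta> T by (intro mult_mono) auto
    finally show ?thesis
      using \<delta> Q by simp
  qed
  also have "\<dots> = 2 * \<delta> * (- 2 * (T\<^sup>2 * Q)) + \<delta> * (2 * \<delta> + 4 * sqnorm y) * (T * Q)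
      - \<delta> * (\<delta> + 1) * (2 * \<delta> / 3 + 4 * sqnorm y) * Q"
    by (simp add: q power2_eq_square) (simp add: field_simps)
  finally have "2 * (2 * \<delta>) * ?F T \<le> 2 * \<delta> * (2 * ?F T) + (2 * \<delta> * (- 2 * (T\<^sup>2 * Q)) + \<delta> * (2 * \<delta> + 4 * sqnorm y) * (T * Q)
      - \<delta> * (\<delta> + 1) * (2 * \<delta> / 3 + 4 * sqnorm y) * Q)"
    by simp
  also have "\<dots> = (\<Sum>i\<in>UNIV. 2 * ?F T - 2 * (T\<^sup>2 * Q) + \<delta> * (1 + 4 * (?b i)\<^sup>2) * (T * Q) - \<delta> * (\<delta> + 1) * (1 / 3 + 4 * (?b i)\<^sup>2) * Q)"
    by (simp add: sum.distrib sum_subtractf sum_distrib_left[symmetric] sum_distrib_right[symmetric] card sqnorm_def[symmetric])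
      (simp add: right_diff_distrib)
  also have "\<dots> \<le> (\<Sum>i\<in>UNIV. ?F (sqnorm (y + axis i 1) - CARD('d)) + ?F (sqnorm (y + axis i (- 1)) - CARD('d)))"
    by (intro sum_mono pair)
  finally show ?thesis
    by (simp add: sum_unit_steps card_unit_steps card T_def)
qed

section \<open>A potential that is subharmonic off the origin\<close>

definition l1norm :: "int ^ 'd \<Rightarrow> nat" where
  "l1norm y = (\<Sum>i\<in>UNIV. nat \<bar>y $ i\<bar>)"

lemma l1norm_le_sqnorm: "real (l1norm y) \<le> sqnorm y"
proof -
  have "real (nat \<bar>b\<bar>) \<le> (real_of_int b)\<^sup>2" for b
  proof -
    have "\<bar>b\<bar> * 1 \<le> \<bar>b\<bar> * \<bar>b\<bar>"
      using mult_left_mono[of 1 "\<bar>b\<bar>" "\<bar>b\<bar>"] by (cases "b = 0") auto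
    then have "real_of_int \<bar>b\<bar> \<le> real_of_int (b\<^sup>2)"
      by (simp only: of_int_le_iff) (simp only: power2_eq_square abs_mult_self_eq mult_1_right)
    then show ?thesis by simp
  qed
  then show ?thesis
    unfolding l1norm_def sqnorm_def of_nat_sum by (intro sum_mono)
qed

lemma step_towards_origin:
  fixes y :: "int ^ 'd"
  assumes "y \<noteq> 0"
  obtains e where "e \<in> unit_steps" "sqnorm (y + e) < sqnorm y" "l1norm y = Suc (l1norm (y + e))"
proof -
  obtain i where i: "y $ i \<noteq> 0"
    using assms by (auto simp: vec_eq_iff)
  define c where "c = - sgn (y $ i)"
  have c: "c \<in> {- 1, 1}" "nat \<bar>y $ i\<bar> = Suc (nat \<bar>y $ i + c\<bar>)" "of_int c * real_of_int (y $ i) \<le> - 1" "c\<^sup>2 = 1"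
    using i by (auto simp: c_def sgn_if)
  have "(\<Sum>j\<in>UNIV - {i}. nat \<bar>(y + axis i c) $ j\<bar>) = (\<Sum>j\<in>UNIV - {i}. nat \<bar>y $ j\<bar>)"
    by (rule sum.cong) (auto simp: axis_def)
  then have "l1norm y = Suc (l1norm (y + axis i c))"
    unfolding l1norm_def using c(2) by (simp add: sum.remove[of UNIV i] axis_def)
  moreover have "sqnorm (y + axis i c) < sqnorm y"
    using c by (auto simp: sqnorm_step)
  moreover have "axis i c \<in> unit_steps"
    using c(1) by (auto simp: unit_steps_def)
  ultimately show ?thesis
    using that by blast
qed

text \<open>
  Close to the origin the shifted radial function is not subharmonic, or not even meaningful.
  There it is replaced by a function that grows by a factor \<open>2 d\<close>, the number of neighbours, with
  each step towards the origin: one neighbour alone then provides the whole sum that subharmonicity asks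
  for. The exponent is chosen so that this inner part is everywhere at least the height, the value
  \<open>radial d 1 - radial d S\<close>, hence lies above the outer part wherever the latter has to be compared with it. The threshold
  \<open>9 * d\<close> for the squared norm is where \<open>radial_subharmonic\<close> takes over.
\<close>

definition potential :: "real \<Rightarrow> int ^ 'd \<Rightarrow> real" where
  "potential S y =
    (if sqnorm y < 9 * CARD('d)
     then (radial CARD('d) 1 - radial CARD('d) S) * (2 * CARD('d)) ^ (9 * CARD('d) - l1norm y)
     else max 0 (radial CARD('d) (sqnorm y - CARD('d)) - radial CARD('d) S))"

context
  fixes S :: real
  assumes d: "CARD('d :: finite) \<ge> 2" and S: "S \<ge> 1"
begin

lemma height_nonneg: "0 \<le> radial CARD('d) 1 - radial CARD('d) S"
  using radial_antimono[of 1 S "CARD('d)"] d S by simp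

lemma height_le_near:
  "radial CARD('d) 1 - radial CARD('d) S \<le>
    (radial CARD('d) 1 - radial CARD('d) S) * (2 * real CARD('d)) ^ n"
proof -
  have "1 \<le> (2 * real CARD('d)) ^ n"
    using d by (intro one_le_power) simp
  then show ?thesis
    using mult_left_mono[OF _ height_nonneg, of 1] by simp
qed

lemma potential_nonneg: "0 \<le> potential S (y :: int ^ 'd)"
  using height_nonneg by (simp add: potential_def)

lemma potential_ge_shifted_radial:
  fixes y :: "int ^ 'd"
  assumes "1 \<le> T" "sqnorm y - CARD('d) \<le> T"
  shows "radial CARD('d) T - radial CARD('d) S \<le> potential S y"
proof (cases "sqnorm y < 9 * CARD('d)")
  case True
  then show ?thesis
    using height_le_near[of "9 * CARD('d) - l1norm y"] radial_antimono[of 1 T "CARD('d)"] assms d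
    by (simp add: potential_def)
next
  case False
  moreover have "0 < sqnorm y - CARD('d)"
    using False d by linarith
  ultimately show ?thesis
    using radial_antimono[of "sqnorm y - CARD('d)" T "CARD('d)"] assms d
    by (simp add: potential_def)
qed

lemma potential_origin:
  "potential S (0 :: int ^ 'd) = (radial CARD('d) 1 - radial CARD('d) S) * (2 * CARD('d)) ^ (9 * CARD('d))"
  by (simp add: potential_def sqnorm_def l1norm_def)

lemma potential_le_origin: "potential S (y :: int ^ 'd) \<le> potential S (0 :: int ^ 'd)"
proof (cases "sqnorm y < 9 * CARD('d)")
  case True
  have "(2 * real CARD('d)) ^ (9 * CARD('d) - l1norm y) \<le> (2 * real CARD('d)) ^ (9 * CARD('d))"
    using d by (intro power_increasing) auto
  then show ?thesis
    using True height_nonneg mult_left_mono[OF _ height_nonneg]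
    by (simp add: potential_origin) (simp add: potential_def)
next
  case False
  then have "1 \<le> sqnorm y - CARD('d)"
    using d by linarith
  then have "radial CARD('d) (sqnorm y - CARD('d)) \<le> radial CARD('d) 1"
    using d by (intro radial_antimono) auto
  then show ?thesis
    using False height_le_near[of "9 * CARD('d)"] height_nonneg
    by (simp add: potential_origin) (simp add: potential_def)
qed

text \<open>
  In the inner region a single step towards the origin suffices. In the outer region the potential is
  the maximum of 0 and a subharmonic function which it dominates at all neighbours, including those in the inner region.
\<close>

lemma potential_subharmonic:
  fixes y :: "int ^ 'd"
  assumes "y \<noteq> 0"
  shows "card (unit_steps :: (int ^ 'd) set) * potential S y \<le> (\<Sum>e\<in>unit_steps. potential S (y + e))"
proof (cases "sqnorm y < 9 * CARD('d)")
  case True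
  obtain e where e: "e \<in> unit_steps" "sqnorm (y + e) < sqnorm y" "l1norm y = Suc (l1norm (y + e))"
    using step_towards_origin[OF assms] .
  have "l1norm y < 9 * CARD('d)"
    using l1norm_le_sqnorm[of y] True by linarith
  then have "9 * CARD('d) - l1norm (y + e) = Suc (9 * CARD('d) - l1norm y)"
    using e(3) by linarith
  then have "card (unit_steps :: (int ^ 'd) set) * potential S y = potential S (y + e)"
    using True e(2) by (simp add: potential_def card_unit_steps)
  also have "\<dots> \<le> (\<Sum>e\<in>unit_steps. potential S (y + e))"
    using e(1) by (intro member_le_sum) (auto simp: potential_nonneg finite_unit_steps)
  finally show ?thesis .
next
  case False
  let ?U = "unit_steps :: (int ^ 'd) set"
  let ?F = "\<lambda>y. radial CARD('d) (sqnorm y - CARD('d))"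
  have nb: "1 \<le> sqnorm (y + e) - CARD('d)" if "e \<in> ?U" for e
    using that radial_shifted_neighbours[OF d, of y] False by (auto simp: unit_steps_def)
  have "card ?U * (?F y - radial CARD('d) S) \<le> (\<Sum>e\<in>?U. ?F (y + e) - radial CARD('d) S)"
    using radial_subharmonic[OF d, of y] False by (simp add: sum_subtractf algebra_simps)
  also have "\<dots> \<le> (\<Sum>e\<in>?U. potential S (y + e))"
    by (intro sum_mono potential_ge_shifted_radial nb order_refl)
  finally have "card ?U * (?F y - radial CARD('d) S) \<le> (\<Sum>e\<in>?U. potential S (y + e))" .
  moreover have "0 \<le> (\<Sum>e\<in>?U. potential S (y + e))"
    by (intro sum_nonneg potential_nonneg)
  ultimately show ?thesis
    using False by (simp add: potential_def max_def)
qed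

lemma potential_eq_0:
  fixes y :: "int ^ 'd"
  assumes "sqnorm y \<ge> S + 9 * CARD('d)"
  shows "potential S y = 0"
proof -
  have "radial CARD('d) (sqnorm y - CARD('d)) \<le> radial CARD('d) S"
    using assms S d by (intro radial_antimono) auto
  then show ?thesis
    using assms S by (simp add: potential_def)
qed

text \<open>
  With an exponent \<open>(1 - d) / 2\<close> on the squared norm, the sum over the \<open>j\<close>-th lattice shell is bounded
  uniformly in \<open>j\<close>, so this bound is summable to the order \<open>sqrt S\<close> times the radius of the support.
\<close>

lemma potential_le_powr:
  fixes y :: "int ^ 'd"
  assumes "y \<noteq> 0"
  shows "potential S y \<le>
    2 * (2 * CARD('d)) ^ (9 * CARD('d)) * (9 * CARD('d)) powr (CARD('d) / 2) * sqrt S * sqnorm y powr (1 / 2 - CARD('d) / 2)"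
proof -
  define D where "D = real CARD('d)"
  have D: "D \<ge> 2" using d by (simp add: D_def)
  have q: "sqnorm y \<ge> 1"
  proof -
    obtain i where "y $ i \<noteq> 0" using assms by (auto simp: vec_eq_iff)
    then have "1 \<le> (y $ i)\<^sup>2"
      by (metis int_one_le_iff_zero_less zero_less_power2)
    then have "1 \<le> (real_of_int (y $ i))\<^sup>2"
      by (metis of_int_1_le_iff of_int_power)
    then show ?thesis
      using coord_sq_le_sqnorm[of y i] by linarith
  qed
  let ?P = "(2 * D) ^ (9 * CARD('d))"
  let ?K = "(9 * D) powr (D / 2)"
  have P: "?P \<ge> 1" using D by (intro one_le_power) simp
  have K: "(9 * D) powr (D / 2 - 1 / 2) \<le> ?K" using D by (intro powr_mono) auto
  have K1: "?K \<ge> 1" using D by (intro ge_one_powr_ge_zero) auto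
  have "potential S y \<le> 2 * ?P * ?K * sqrt S * sqnorm y powr (1 / 2 - D / 2)"
  proof (cases "sqnorm y < 9 * CARD('d)")
    case True
    have "(9 * D) powr (1 / 2 - D / 2) \<le> sqnorm y powr (1 / 2 - D / 2)"
      using True D q by (intro powr_mono2') (auto simp: D_def)
    then have "(9 * D) powr (D / 2 - 1 / 2) * (9 * D) powr (1 / 2 - D / 2) \<le> ?K * sqnorm y powr (1 / 2 - D / 2)"
      by (intro mult_mono K) auto
    then have one: "1 \<le> ?K * sqnorm y powr (1 / 2 - D / 2)"
      using D by (simp add: powr_add[symmetric])
    have "potential S y \<le> potential S (0 :: int ^ 'd)"
      by (rule potential_le_origin)
    also have "\<dots> \<le> (2 * sqrt S) * ?P"
      using radial_diff_le[of 1 S "CARD('d)"] S d P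
      by (auto simp: potential_origin D_def intro!: mult_right_mono)
    also have "\<dots> \<le> (2 * sqrt S) * ?P * (?K * sqnorm y powr (1 / 2 - D / 2))"
    proof -
      have "0 \<le> (2 * sqrt S) * ?P"
        using S P by (intro mult_nonneg_nonneg) auto
      from mult_left_mono[OF one this] show ?thesis by (simp only: mult_1_right)
    qed
    finally show ?thesis by (simp add: mult_ac)
  next
    case False
    then have far: "sqnorm y \<ge> 9 * D" by (simp add: D_def)
    have nn: "0 \<le> 2 * ?P * ?K * sqrt S * sqnorm y powr (1 / 2 - D / 2)"
      using S P by simp
    show ?thesis
    proof (cases "sqnorm y - D \<le> S")
      case True
      have "radial CARD('d) (sqnorm y - D) - radial CARD('d) S \<le> 2 * sqrt S * (sqnorm y - D) powr (1 / 2 - D / 2)"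
        using radial_diff_le[of "sqnorm y - D" S "CARD('d)"] True far D d by (simp add: D_def)
      also have "\<dots> \<le> 2 * sqrt S * (?P * ?K * sqnorm y powr (1 / 2 - D / 2))"
      proof (intro mult_left_mono)
        have "(sqnorm y - D) powr (1 / 2 - D / 2) \<le> (sqnorm y / (9 * D)) powr (1 / 2 - D / 2)"
        proof (intro powr_mono2')
          have "sqnorm y / (9 * D) \<le> sqnorm y / 2"
            using D q by (intro divide_left_mono) auto
          then show "sqnorm y / (9 * D) \<le> sqnorm y - D"
            using far D by linarith
        qed (use D q in auto)
        also have "\<dots> = (9 * D) powr (D / 2 - 1 / 2) * sqnorm y powr (1 / 2 - D / 2)"
          using powr_minus_divide[of "9 * D" "1 / 2 - D / 2"] D q by (simp add: powr_divide)
        also have "\<dots> \<le> (?P * ?K) * sqnorm y powr (1 / 2 - D / 2)"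
          using K P K1 mult_right_mono[OF P, of ?K] by (intro mult_right_mono) auto
        finally show "(sqnorm y - D) powr (1 / 2 - D / 2) \<le> ?P * ?K * sqnorm y powr (1 / 2 - D / 2)" .
      qed (use S in auto)
      finally show ?thesis
        using False nn by (simp add: potential_def D_def mult_ac)
    next
      case False2: False
      have "radial CARD('d) (sqnorm y - D) \<le> radial CARD('d) S"
        using False2 S d by (intro radial_antimono) auto
      then show ?thesis
        using False nn by (simp add: potential_def D_def)
    qed
  qed
  then show ?thesis by (simp add: D_def)
qed

end

section \<open>Summation over lattice cubes\<close>

definition cube :: "nat \<Rightarrow> (int ^ 'd) set" where
  "cube n = {y. \<forall>i. \<bar>y $ i\<bar> \<le> int n}"

lemma finite_cube: "finite (cube n :: (int ^ 'd) set)"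
  and card_cube: "card (cube n :: (int ^ 'd) set) = (2 * n + 1) ^ CARD('d)"
proof -
  let ?I = "{- int n..int n}"
  have bij: "bij_betw vec_nth (cube n :: (int ^ 'd) set) (UNIV \<rightarrow>\<^sub>E ?I)"
    by (rule bij_betwI[where g = vec_lambda]) (auto simp: cube_def abs_le_iff PiE_def Pi_def minus_le_iff)
  have fin: "finite (UNIV \<rightarrow>\<^sub>E ?I :: ('d \<Rightarrow> int) set)"
    by (intro finite_PiE) auto
  show "finite (cube n :: (int ^ 'd) set)"
    using bij_betw_finite[OF bij] fin by simp
  show "card (cube n :: (int ^ 'd) set) = (2 * n + 1) ^ CARD('d)"
    using bij_betw_same_card[OF bij] by (simp add: card_PiE nat_add_distrib nat_mult_distrib)
qed

lemma sqnorm_ge_outside_cube: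
  assumes "y \<notin> cube n"
  shows "(real n + 1)\<^sup>2 \<le> sqnorm y"
proof -
  obtain i where "\<bar>y $ i\<bar> \<ge> int n + 1"
    using assms by (auto simp: cube_def not_le dest: zless_imp_add1_zle)
  then have "\<bar>real_of_int (y $ i)\<bar> \<ge> real n + 1"
    by linarith
  then have "(real n + 1)\<^sup>2 \<le> \<bar>real_of_int (y $ i)\<bar>\<^sup>2"
    by (intro power_mono) auto
  then show ?thesis
    using coord_sq_le_sqnorm[of y i] by simp
qed

lemma power_diff_le:
  fixes x y :: real
  assumes "0 \<le> y" "y \<le> x"
  shows "x ^ n - y ^ n \<le> n * (x - y) * x ^ (n - 1)"
proof -
  have "(\<Sum>i<n. y ^ (n - Suc i) * x ^ i) \<le> (\<Sum>i<n. x ^ (n - 1))"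
  proof (rule sum_mono)
    fix i assume "i \<in> {..<n}"
    then have "n - 1 = (n - Suc i) + i" by auto
    then show "y ^ (n - Suc i) * x ^ i \<le> x ^ (n - 1)"
      using assms by (simp add: power_add mult_right_mono power_mono)
  qed
  then have "(x - y) * (\<Sum>i<n. y ^ (n - Suc i) * x ^ i) \<le> (x - y) * (n * x ^ (n - 1))"
    using assms by (intro mult_left_mono) auto
  then show ?thesis
    by (simp add: power_diff_sumr2 mult_ac)
qed

text \<open>
  Passing from the cube of radius \<open>n\<close> to that of radius \<open>n + 1\<close> adds at most a constant times
  \<open>(n + 1) ^ (d - 1)\<close> points, each contributing at most \<open>1 / (n + 1) ^ (d - 1)\<close>.
\<close>

lemma sum_powr_cube:
  assumes d: "CARD('d :: finite) \<ge> 2"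
  shows "(\<Sum>y\<in>cube n. sqnorm (y :: int ^ 'd) powr (1 / 2 - CARD('d) / 2)) \<le> 2 * real CARD('d) * 3 ^ (CARD('d) - 1) * n"
proof (induction n)
  case 0
  \<comment> \<open>The origin contributes nothing, because \<open>0 powr s = 0\<close>.\<close>
  have "cube 0 = {0 :: int ^ 'd}"
    by (auto simp: cube_def vec_eq_iff)
  then show ?case by (simp add: sqnorm_def)
next
  case (Suc n)
  let ?d = "CARD('d)"
  let ?g = "\<lambda>y :: int ^ 'd. sqnorm y powr (1 / 2 - ?d / 2)"
  let ?A = "cube (Suc n) - cube n :: (int ^ 'd) set"
  have sub: "cube n \<subseteq> (cube (Suc n) :: (int ^ 'd) set)"
    by (auto simp: cube_def intro: order_trans[of _ "int n"])
  have card_A: "real (card ?A) \<le> 2 * real ?d * (2 * n + 3) ^ (?d - 1)"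
  proof -
    have "real (card ?A) = (2 * real n + 3) ^ ?d - (2 * real n + 1) ^ ?d"
      using sub card_mono[OF finite_cube sub]
      by (simp add: card_Diff_subset finite_cube card_cube of_nat_diff) (simp add: add_ac)
    also have "\<dots> \<le> ?d * 2 * (2 * real n + 3) ^ (?d - 1)"
      using power_diff_le[of "2 * real n + 1" "2 * real n + 3" ?d] by simp
    finally show ?thesis by (simp add: add_ac mult_ac)
  qed
  have "?g y \<le> 1 / (real n + 1) ^ (?d - 1)" if "y \<in> ?A" for y
  proof -
    have "?g y \<le> ((real n + 1)\<^sup>2) powr (1 / 2 - ?d / 2)"
      using that sqnorm_ge_outside_cube[of y n] d by (intro powr_mono2') auto
    also have "\<dots> = (real n + 1) powr (- real (?d - 1))"
    proof -
      have exponent: "2 * (1 / 2 - real ?d / 2) = - real (?d - 1)"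
        using d by (simp add: of_nat_diff right_diff_distrib)
      have "((real n + 1)\<^sup>2) = (real n + 1) powr 2"
        by simp
      then show ?thesis
        by (simp only: powr_powr exponent)
    qed
    also have "\<dots> = 1 / (real n + 1) ^ (?d - 1)"
      unfolding powr_minus_divide by (subst powr_realpow) auto
    finally show ?thesis .
  qed
  then have "sum ?g ?A \<le> card ?A * (1 / (real n + 1) ^ (?d - 1))"
    by (rule sum_bounded_above)
  also have "\<dots> \<le> (2 * real ?d * (2 * n + 3) ^ (?d - 1)) * (1 / (real n + 1) ^ (?d - 1))"
    by (intro mult_right_mono card_A) auto
  also have "\<dots> \<le> (2 * real ?d * (3 * (real n + 1)) ^ (?d - 1)) * (1 / (real n + 1) ^ (?d - 1))"
    by (intro mult_right_mono mult_left_mono) (auto intro!: power_mono)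
  also have "\<dots> = 2 * real ?d * 3 ^ (?d - 1)"
    unfolding power_mult_distrib by simp
  finally have "sum ?g ?A \<le> 2 * real ?d * 3 ^ (?d - 1)" .
  moreover have "sum ?g (cube (Suc n)) = sum ?g ?A + sum ?g (cube n)"
    using sub by (intro sum.subset_diff finite_cube)
  ultimately show ?case
    using Suc by (simp add: algebra_simps)
qed

section \<open>Covering the ball\<close>

lemma lattice_ball_iff:
  assumes "r > 0"
  shows "y \<in> lattice_ball x r \<longleftrightarrow> sqnorm (y - x) < r\<^sup>2"
proof -
  have "norm ((\<chi> i. real_of_int (y $ i - x $ i)) :: real ^ 'a) = sqrt (sqnorm (y - x))"
    by (simp add: norm_vec_def L2_set_def sqnorm_def)
  then show ?thesis
    using assms sqnorm_nonneg[of "y - x"] real_sqrt_less_iff[of "sqnorm (y - x)" "r\<^sup>2"]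
    by (simp add: lattice_ball_def)
qed

lemma sqnorm_diff_less:
  assumes "sqnorm x < (a :: real)\<^sup>2" "sqnorm z < b\<^sup>2" "a > 0" "b > 0"
  shows "sqnorm (x - z :: int ^ 'd) < (a + b)\<^sup>2"
proof -
  have norm: "norm ((\<chi> i. real_of_int (y $ i)) :: real ^ 'd) = sqrt (sqnorm y)" for y :: "int ^ 'd"
    by (simp add: norm_vec_def L2_set_def sqnorm_def)
  have "sqrt (sqnorm (x - z)) = norm ((\<chi> i. real_of_int (x $ i)) - (\<chi> i. real_of_int (z $ i)) :: real ^ 'd)"
    unfolding norm[symmetric] by (rule arg_cong[where f = norm]) (simp add: vec_eq_iff)
  also have "\<dots> \<le> sqrt (sqnorm x) + sqrt (sqnorm z)"
    unfolding norm[symmetric] by (rule norm_triangle_ineq4)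
  also have "\<dots> < a + b"
    using real_sqrt_less_iff[of "sqnorm x" "a\<^sup>2"] real_sqrt_less_iff[of "sqnorm z" "b\<^sup>2"] assms
    by (intro add_strict_mono) auto
  finally have "sqrt (sqnorm (x - z)) < a + b" .
  then show ?thesis
    using sqnorm_nonneg[of "x - z"] by (metis real_sqrt_less_iff real_sqrt_abs abs_of_pos assms(3,4) add_pos_pos)
qed

lemma card_lattice_ball_le:
  assumes "R \<ge> 1"
  shows "finite (lattice_ball (0 :: int ^ 'd) R)"
    and "real (card (lattice_ball (0 :: int ^ 'd) R)) \<le> (3 * R) ^ CARD('d)"
proof -
  define n where "n = nat \<lfloor>R\<rfloor>"
  have n: "real n \<le> R" "R < real n + 1"
    using assms by (simp_all add: n_def)
  have sub: "lattice_ball (0 :: int ^ 'd) R \<subseteq> cube n"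
  proof
    fix y :: "int ^ 'd" assume "y \<in> lattice_ball 0 R"
    then have "sqnorm y < R\<^sup>2"
      using lattice_ball_iff[of R y 0] assms by simp
    also have "\<dots> \<le> (real n + 1)\<^sup>2"
      using n assms by (intro power_mono) auto
    finally show "y \<in> cube n"
      using sqnorm_ge_outside_cube[of y n] by fastforce
  qed
  then show "finite (lattice_ball (0 :: int ^ 'd) R)"
    using finite_cube finite_subset by blast
  have "real (card (lattice_ball (0 :: int ^ 'd) R)) \<le> real (card (cube n :: (int ^ 'd) set))"
    using sub finite_cube card_mono by (intro of_nat_mono) blast
  also have "\<dots> = (2 * real n + 1) ^ CARD('d)"
    by (simp add: card_cube add_ac)
  also have "\<dots> \<le> (3 * R) ^ CARD('d)"
    using n assms by (intro power_mono) auto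
  finally show "real (card (lattice_ball (0 :: int ^ 'd) R)) \<le> (3 * R) ^ CARD('d)" .
qed

text \<open>
  The potential is of size at most \<open>sqrt S\<close> times a summand whose sum grows linearly with the
  radius, and its support has radius of order \<open>sqrt S\<close>. The origin is accounted for separately.
\<close>

lemma sum_potential_le:
  assumes d: "CARD('d :: finite) \<ge> 2"
  obtains C where "C > 0" and "\<And>S. S \<ge> 1 \<Longrightarrow> \<exists>D. finite D \<and> (\<forall>y :: int ^ 'd. y \<notin> D \<longrightarrow> potential S y = 0) \<and>
    (\<Sum>y\<in>D. potential S y) \<le> C * S"
proof
  let ?d = "CARD('d)"
  define B where "B = 2 * (2 * real ?d) ^ (9 * ?d) * (9 * real ?d) powr (?d / 2)"
  define C where "C = B * (1 + 2 * real ?d * 3 ^ (?d - 1) * sqrt (10 * real ?d))"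
  have B: "B > 0"
    using d by (simp add: B_def)
  have B0: "2 * (2 * real ?d) ^ (9 * ?d) \<le> B"
  proof -
    have "1 \<le> (9 * real ?d) powr (?d / 2)"
      using d by (intro ge_one_powr_ge_zero) auto
    then show ?thesis
      using mult_left_mono[of 1 _ "2 * (2 * real ?d) ^ (9 * ?d)"] by (simp add: B_def)
  qed
  show "C > 0"
    unfolding C_def using B by (intro mult_pos_pos add_pos_nonneg) auto
  fix S :: real assume S: "S \<ge> 1"
  define n where "n = nat \<lfloor>sqrt (S + 9 * ?d)\<rfloor>"
  have n: "real n \<le> sqrt (S + 9 * ?d)" "sqrt (S + 9 * ?d) < real n + 1"
    using S by (simp_all add: n_def)
  have n_le: "real n \<le> sqrt (10 * real ?d) * sqrt S"
  proof -
    have "1 * S \<le> ?d * S" "9 * real ?d * 1 \<le> 9 * real ?d * S"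
      using d S by (intro mult_right_mono mult_left_mono; simp)+
    then have "S + 9 * ?d \<le> 10 * real ?d * S"
      by linarith
    then have "sqrt (S + 9 * ?d) \<le> sqrt (10 * real ?d) * sqrt S"
      by (simp add: real_sqrt_mult[symmetric])
    with n show ?thesis by linarith
  qed
  have zero: "potential S y = 0" if "y \<notin> cube n" for y :: "int ^ 'd"
  proof (rule potential_eq_0[OF d S])
    have "S + 9 * ?d = (sqrt (S + 9 * ?d))\<^sup>2"
      using S by simp
    also have "\<dots> \<le> (real n + 1)\<^sup>2"
      using n S by (intro power_mono) auto
    also have "\<dots> \<le> sqnorm y"
      using sqnorm_ge_outside_cube[OF that] .
    finally show "S + 9 * ?d \<le> sqnorm y" .
  qed
  have "potential S y \<le> B * sqrt S * (of_bool (y = 0) + sqnorm y powr (1 / 2 - ?d / 2))" for y :: "int ^ 'd"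
  proof (cases "y = 0")
    case True
    have "potential S (0 :: int ^ 'd) \<le> 2 * sqrt S * (2 * real ?d) ^ (9 * ?d)"
      using radial_diff_le[of 1 S ?d] S d by (auto simp: potential_origin[OF d S] intro!: mult_right_mono)
    also have "\<dots> \<le> B * sqrt S"
      using mult_right_mono[OF B0, of "sqrt S"] S by (simp add: mult_ac)
    finally show ?thesis
      using True by (simp add: sqnorm_def)
  next
    case False
    then show ?thesis
      using potential_le_powr[OF d S, of y] by (simp add: B_def)
  qed
  then have "(\<Sum>y\<in>cube n. potential S (y :: int ^ 'd))
      \<le> (\<Sum>y\<in>cube n. B * sqrt S * (of_bool (y = 0) + sqnorm (y :: int ^ 'd) powr (1 / 2 - ?d / 2)))"
    by (rule sum_mono)
  also have "\<dots> = B * sqrt S * (1 + (\<Sum>y\<in>cube n. sqnorm (y :: int ^ 'd) powr (1 / 2 - ?d / 2)))"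
  proof -
    have "(\<Sum>y\<in>cube n. of_bool (y = (0 :: int ^ 'd))) = (1 :: real)"
      by (simp add: of_bool_def finite_cube sum.delta) (simp add: cube_def)
    then show ?thesis
      by (simp add: sum_distrib_left[symmetric] sum.distrib)
  qed
  also have "\<dots> \<le> B * sqrt S * (sqrt S + 2 * real ?d * 3 ^ (?d - 1) * (sqrt (10 * real ?d) * sqrt S))"
  proof (intro mult_left_mono add_mono)
    have "(\<Sum>y\<in>cube n. sqnorm (y :: int ^ 'd) powr (1 / 2 - ?d / 2)) \<le> 2 * real ?d * 3 ^ (?d - 1) * n"
      by (rule sum_powr_cube[OF d])
    also have "\<dots> \<le> 2 * real ?d * 3 ^ (?d - 1) * (sqrt (10 * real ?d) * sqrt S)"
      by (intro mult_left_mono n_le) simp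
    finally show "(\<Sum>y\<in>cube n. sqnorm (y :: int ^ 'd) powr (1 / 2 - ?d / 2)) \<le> \<dots>" .
  qed (use S B in auto)
  also have "\<dots> = C * (sqrt S * sqrt S)"
    by (simp add: C_def algebra_simps)
  also have "\<dots> = C * S"
    using S by simp
  finally show "\<exists>D. finite D \<and> (\<forall>y :: int ^ 'd. y \<notin> D \<longrightarrow> potential S y = 0) \<and>
    (\<Sum>y\<in>D. potential S y) \<le> C * S"
    using zero finite_cube by blast
qed

text \<open>
  The starting points are at distance less than \<open>3 R / 2\<close> from \<open>z\<close>, well inside the support of radius about
  \<open>2 R\<close> of the potential centred at \<open>z\<close>, so each explorer contributes at least \<open>R\<^sup>2 / (2 R)\<^sup>d\<close> (before
  normalisation). For large \<open>A\<close> half of the total is at least twice the sum of the potential over the lattice.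
\<close>

lemma prob_uncovered_site:
  assumes d: "CARD('d :: finite) \<ge> 2"
  obtains C where "C > 0"
    and "\<And>R A (z :: int ^ 'd) (xs :: (int ^ 'd) list). \<lbrakk>R \<ge> 1; A \<ge> C; z \<in> lattice_ball 0 R; set xs \<subseteq> lattice_ball 0 (R / 2);
      int (length xs) = \<lfloor>A * R ^ CARD('d)\<rfloor>\<rbrakk>
      \<Longrightarrow> \<P>(\<xi> in walk_steps. z \<notin> idla_cluster xs \<xi>)
        \<le> exp (- (A * R\<^sup>2 / (2 ^ (CARD('d) + 3) * potential (4 * R\<^sup>2) (0 :: int ^ 'd))))"
proof -
  let ?d = "CARD('d)"
  obtain C where C: "C > 0" "\<And>S. S \<ge> 1 \<Longrightarrow> \<exists>D. finite D \<and> (\<forall>y :: int ^ 'd. y \<notin> D \<longrightarrow> potential S y = 0) \<and>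
    (\<Sum>y\<in>D. potential S y) \<le> C * S"
    by (rule sum_potential_le[OF d]) (rule that)
  define C' where "C' = max 2 (2 ^ (?d + 5) * C)"
  show ?thesis
  proof (rule that)
    show "C' > 0" by (simp add: C'_def)
    fix R A :: real and z :: "int ^ 'd" and xs :: "(int ^ 'd) list"
    assume R: "R \<ge> 1" and A: "A \<ge> C'" and z: "z \<in> lattice_ball 0 R" and xs: "set xs \<subseteq> lattice_ball 0 (R / 2)"
      and len: "int (length xs) = \<lfloor>A * R ^ ?d\<rfloor>"
    define S where "S = 4 * R\<^sup>2"
    define G where "G = potential S (0 :: int ^ 'd)"
    define h where "h y = potential S (y - z) / G" for y :: "int ^ 'd"
    have R2: "R\<^sup>2 \<ge> 1"
      using R by (rule one_le_power)
    then have S: "S \<ge> 1" "S > 1"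
      by (simp_all add: S_def)
    have low: "R\<^sup>2 / (2 * R) ^ ?d \<le> radial ?d T - radial ?d S" if "1 \<le> T" "T \<le> 9 / 4 * R\<^sup>2" for T
    proof -
      have "R\<^sup>2 / (2 * R) ^ ?d = R\<^sup>2 * S powr (- real ?d / 2)"
      proof -
        have "S = (2 * R) powr 2"
          using R by (simp add: S_def power2_eq_square)
        then have "S powr (- real ?d / 2) = (2 * R) powr (- real ?d)"
          by (simp only: powr_powr) simp
        also have "\<dots> = 1 / (2 * R) ^ ?d"
          unfolding powr_minus_divide using R by (subst powr_realpow) auto
        finally show ?thesis by simp
      qed
      also have "\<dots> \<le> (S - T) * S powr (- real ?d / 2)"
        using that R2 by (intro mult_right_mono) (auto simp: S_def)
      also have "\<dots> \<le> radial ?d T - radial ?d S"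
        using that R2 d by (intro radial_diff_ge) (auto simp: S_def)
      finally show ?thesis .
    qed
    have ratio: "R\<^sup>2 / (2 * R) ^ ?d > 0"
      using R by simp
    have G: "G > 0"
    proof -
      have "radial ?d 1 - radial ?d S \<le> G"
        unfolding G_def using d by (intro potential_ge_shifted_radial[OF d S(1)]) (auto simp: sqnorm_def)
      with low[of 1] ratio R2 show ?thesis by simp
    qed
    obtain D where D: "finite D" "\<And>y :: int ^ 'd. y \<notin> D \<Longrightarrow> potential S y = 0" "(\<Sum>y\<in>D. potential S y) \<le> C * S"
      using C(2)[OF S(1)] by blast
    have "\<P>(\<xi> in walk_steps. z \<notin> idla_cluster xs \<xi>)
        \<le> exp ((\<Sum>y\<in>(\<lambda>y. y + z) ` D. h y) - (\<Sum>x\<leftarrow>xs. h x) / 2)"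
    proof (rule prob_uncovered_le)
      show "0 \<le> h y" "h y \<le> 1" for y
        using potential_nonneg[OF d S(1)] potential_le_origin[OF d S(1)] G
        by (simp_all add: h_def G_def)
      show "card (unit_steps :: (int ^ 'd) set) * h y \<le> (\<Sum>e\<in>unit_steps. h (y + e))" if "y \<noteq> z" for y
        using potential_subharmonic[OF d S(1), of "y - z"] that G
        by (simp add: h_def sum_divide_distrib[symmetric] divide_right_mono add_diff_eq add.commute diff_add_eq)
      show "h y = 0" if "y \<notin> (\<lambda>y. y + z) ` D" for y
      proof -
        have "y - z \<notin> D"
          using that by (force intro: rev_image_eqI)
        then show ?thesis
          using D(2) by (simp add: h_def)
      qed
    qed (use D(1) in simp)
    also have "\<dots> \<le> exp (- (A * R\<^sup>2 / (2 ^ (?d + 3) * G)))"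
    proof -
      have "(\<Sum>y\<in>(\<lambda>y. y + z) ` D. h y) = (\<Sum>y\<in>D. potential S y) / G"
        by (subst sum.reindex) (auto simp: inj_on_def h_def sum_divide_distrib)
      also have "\<dots> \<le> C * S / G"
        using D(3) G by (intro divide_right_mono) auto
      finally have up: "(\<Sum>y\<in>(\<lambda>y. y + z) ` D. h y) \<le> 4 * C * R\<^sup>2 / G"
        by (simp add: S_def mult_ac)
      have each: "R\<^sup>2 / (2 * R) ^ ?d / G \<le> h x" if "x \<in> set xs" for x
      proof -
        have "sqnorm x < (R / 2)\<^sup>2" "sqnorm z < R\<^sup>2"
          using that xs z R lattice_ball_iff[of "R / 2" x 0] lattice_ball_iff[of R z 0] by auto
        then have "sqnorm (x - z) < (R / 2 + R)\<^sup>2"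
          using R by (intro sqnorm_diff_less) auto
        then have "sqnorm (x - z) - ?d \<le> 9 / 4 * R\<^sup>2"
          by (simp add: power2_eq_square)
        then have "radial ?d (9 / 4 * R\<^sup>2) - radial ?d S \<le> potential S (x - z)"
          using R2 by (intro potential_ge_shifted_radial[OF d S(1)]) auto
        then show ?thesis
          using low[of "9 / 4 * R\<^sup>2"] R2 G unfolding h_def by (intro divide_right_mono) auto
      qed
      have "A * R ^ ?d / 2 \<le> length xs"
      proof -
        have "1 \<le> R ^ ?d"
          using R by (rule one_le_power)
        then have "2 * 1 \<le> A * R ^ ?d"
          using A by (intro mult_mono) (auto simp: C'_def)
        then show ?thesis
          using len by linarith
      qed
      then have "A * R ^ ?d / 2 * (R\<^sup>2 / (2 * R) ^ ?d / G) \<le> length xs * (R\<^sup>2 / (2 * R) ^ ?d / G)"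
        using R G by (intro mult_right_mono) auto
      also have "\<dots> = (\<Sum>x\<leftarrow>xs. R\<^sup>2 / (2 * R) ^ ?d / G)"
        by (simp add: sum_list_triv)
      also have "\<dots> \<le> (\<Sum>x\<leftarrow>xs. h x)"
        by (rule sum_list_mono) (rule each)
      finally have "A * R\<^sup>2 / (2 * 2 ^ ?d * G) \<le> (\<Sum>x\<leftarrow>xs. h x)"
        using R by (simp add: power_mult_distrib)
      moreover have "4 * C * R\<^sup>2 / G \<le> A * R\<^sup>2 / (2 ^ (?d + 3) * G)"
      proof -
        have "4 * C \<le> A / 2 ^ (?d + 3)"
          using A by (simp add: C'_def power_add field_simps)
        then have "4 * C * (R\<^sup>2 / G) \<le> A / 2 ^ (?d + 3) * (R\<^sup>2 / G)"
          using G by (intro mult_right_mono) auto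
        then show ?thesis by simp
      qed
      moreover have "A * R\<^sup>2 / (2 * 2 ^ ?d * G) / 2 = 2 * (A * R\<^sup>2 / (2 ^ (?d + 3) * G))"
        by (simp add: power_add)
      ultimately show ?thesis
        using up by simp
    qed
    finally show "\<P>(\<xi> in walk_steps. z \<notin> idla_cluster xs \<xi>)
        \<le> exp (- (A * R\<^sup>2 / (2 ^ (?d + 3) * potential (4 * R\<^sup>2) (0 :: int ^ 'd))))"
      by (simp add: G_def S_def)
  qed
qed

text \<open>
  The height \<open>radial d 1 - radial d (4 R\<^sup>2)\<close> is bounded in \<open>R\<close> for \<open>d \<ge> 3\<close> and equals \<open>ln (4 R\<^sup>2)\<close> for
  \<open>d = 2\<close>: this is the source of the logarithm in the planar case.
\<close>

lemma potential_origin_le: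
  assumes d: "CARD('d :: finite) \<ge> 2" and R: "R \<ge> 2"
  shows "potential (4 * R\<^sup>2) (0 :: int ^ 'd)
    \<le> 4 * (2 * real CARD('d)) ^ (9 * CARD('d)) * (if CARD('d) = 2 then ln R else 1)"
proof -
  let ?d = "CARD('d)"
  have "1 \<le> R\<^sup>2"
    using R by (intro one_le_power) simp
  then have S: "1 \<le> 4 * R\<^sup>2"
    by linarith
  have "radial ?d 1 - radial ?d (4 * R\<^sup>2) \<le> 4 * (if ?d = 2 then ln R else 1)"
  proof (cases "?d = 2")
    case True
    have "4 * R\<^sup>2 \<le> R ^ 4"
    proof -
      have "2\<^sup>2 * R\<^sup>2 \<le> R\<^sup>2 * R\<^sup>2"
        using R by (intro mult_right_mono power_mono) auto
      then show ?thesis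
        by (simp add: power2_eq_square power4_eq_xxxx)
    qed
    then have "ln (4 * R\<^sup>2) \<le> ln (R ^ 4)"
      using R by simp
    also have "\<dots> = 4 * ln R"
      using R by (simp add: ln_realpow)
    finally show ?thesis
      using True by (simp add: radial_def)
  next
    case False
    then have "real ?d \<ge> 3"
      using d by simp
    then have "1 / (real ?d / 2 - 1) \<le> 4" and "0 \<le> (4 * R\<^sup>2) powr (1 - real ?d / 2) / (real ?d / 2 - 1)"
      by (simp_all add: field_simps)
    then show ?thesis
      using False by (simp add: radial_def)
  qed
  from mult_right_mono[OF this, of "(2 * real ?d) ^ (9 * ?d)"] show ?thesis
    by (simp add: potential_origin[OF d S] mult_ac)
qed

text \<open>
  The number of sites in the ball is polynomial in \<open>R\<close>. It is absorbed by giving up half of the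
  exponent obtained for a single site.
\<close>

lemma prob_uncovered_ball:
  assumes d: "CARD('d :: finite) \<ge> 2"
  obtains \<kappa> A0 where "\<kappa> > 0"
    and "\<And>R A (xs :: (int ^ 'd) list). \<lbrakk>R \<ge> 2; A \<ge> A0; set xs \<subseteq> lattice_ball 0 (R / 2);
      int (length xs) = \<lfloor>A * R ^ CARD('d)\<rfloor>\<rbrakk>
      \<Longrightarrow> \<P>(\<xi> in walk_steps. \<not> lattice_ball 0 R \<subseteq> idla_cluster xs \<xi>)
        \<le> exp (- \<kappa> * (A * R\<^sup>2 / (if CARD('d) = 2 then ln R else 1)))"
proof -
  let ?d = "CARD('d)"
  define P where "P = (2 * real ?d) ^ (9 * ?d)"
  have P: "P > 0"
    using d by (simp add: P_def)
  \<comment> \<open>Half the constant of \<open>prob_uncovered_site\<close>, after bounding the potential at the origin by \<open>4 * P * L\<close>.\<close>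
  define \<kappa> where "\<kappa> = 1 / (2 ^ (?d + 6) * P)"
  have \<kappa>: "\<kappa> > 0"
    using P by (simp add: \<kappa>_def)
  obtain C where C: "C > 0"
    "\<And>R A (z :: int ^ 'd) (xs :: (int ^ 'd) list). \<lbrakk>R \<ge> 1; A \<ge> C; z \<in> lattice_ball 0 R; set xs \<subseteq> lattice_ball 0 (R / 2);
      int (length xs) = \<lfloor>A * R ^ ?d\<rfloor>\<rbrakk>
      \<Longrightarrow> \<P>(\<xi> in walk_steps. z \<notin> idla_cluster xs \<xi>)
        \<le> exp (- (A * R\<^sup>2 / (2 ^ (?d + 3) * potential (4 * R\<^sup>2) (0 :: int ^ 'd))))"
    by (rule prob_uncovered_site[OF d]) (rule that)
  show ?thesis
  proof (rule that[OF \<kappa>])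
    fix R A :: real and xs :: "(int ^ 'd) list"
    assume R: "R \<ge> 2" and A: "A \<ge> max C (3 * ?d / \<kappa>)" and xs: "set xs \<subseteq> lattice_ball 0 (R / 2)"
      and len: "int (length xs) = \<lfloor>A * R ^ ?d\<rfloor>"
    let ?M = "walk_steps :: (nat \<times> nat \<Rightarrow> int ^ 'd) measure"
    let ?B = "lattice_ball (0 :: int ^ 'd) R"
    define L where "L = (if ?d = 2 then ln R else 1)"
    define X where "X = A * R\<^sup>2 / L"
    interpret prob_space ?M by (rule prob_space_walk_steps)
    have L: "0 < L" "L \<le> R"
      using R ln_le_minus_one[of R] by (auto simp: L_def)
    have A0: "A > 0"
      using A C(1) by simp
    have site: "\<P>(\<xi> in ?M. z \<notin> idla_cluster xs \<xi>) \<le> exp (- 2 * \<kappa> * X)" if "z \<in> ?B" for z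
    proof -
      let ?G = "potential (4 * R\<^sup>2) (0 :: int ^ 'd)"
      have G: "?G \<le> 4 * P * L"
        using potential_origin_le[OF d R] by (simp add: P_def L_def)
      have "?G > 0"
      proof -
        have R2: "1 \<le> R\<^sup>2"
          using R by (intro one_le_power) simp
        then have S: "1 \<le> 4 * R\<^sup>2"
          by linarith
        have "0 < 4 * R\<^sup>2 - 1"
          using R2 by linarith
        then have "0 < (4 * R\<^sup>2 - 1) * (4 * R\<^sup>2) powr (- real ?d / 2)"
          using R by (intro mult_pos_pos) auto
        also have "\<dots> \<le> radial ?d 1 - radial ?d (4 * R\<^sup>2)"
          using S d by (intro radial_diff_ge) auto
        also have "\<dots> \<le> ?G"
          using d by (intro potential_ge_shifted_radial[OF d S]) (auto simp: sqnorm_def)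
        finally show ?thesis .
      qed
      then have "A * R\<^sup>2 / (2 ^ (?d + 3) * (4 * P * L)) \<le> A * R\<^sup>2 / (2 ^ (?d + 3) * ?G)"
        using G A0 P L by (intro divide_left_mono mult_left_mono mult_pos_pos) auto
      moreover have "A * R\<^sup>2 / (2 ^ (?d + 3) * (4 * P * L)) = 2 * \<kappa> * X"
        by (simp add: \<kappa>_def X_def power_add)
      ultimately have "exp (- (A * R\<^sup>2 / (2 ^ (?d + 3) * ?G))) \<le> exp (- 2 * \<kappa> * X)"
        by simp
      then show ?thesis
        using C(2)[OF _ _ that xs len] R A by (intro order_trans[OF C(2)[OF _ _ that xs len]]) auto
    qed
    have "\<P>(\<xi> in ?M. \<not> ?B \<subseteq> idla_cluster xs \<xi>) = prob (\<Union>z\<in>?B. {\<xi> \<in> space ?M. z \<notin> idla_cluster xs \<xi>})"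
      by (rule arg_cong[where f = prob]) auto
    also have "\<dots> \<le> (\<Sum>z\<in>?B. \<P>(\<xi> in ?M. z \<notin> idla_cluster xs \<xi>))"
    proof (rule finite_measure_subadditive_finite)
      show "finite ?B"
        using R by (intro card_lattice_ball_le) simp
      have "{\<xi>. z \<notin> idla_cluster xs \<xi>} \<in> sets ?M" for z
        using sets_not_covered[of "{z}" xs] by simp
      then show "(\<lambda>z. {\<xi> \<in> space ?M. z \<notin> idla_cluster xs \<xi>}) ` ?B \<subseteq> sets ?M"
        by auto
    qed
    also have "\<dots> \<le> card ?B * exp (- 2 * \<kappa> * X)"
      by (rule sum_bounded_above) (rule site)
    also have "\<dots> \<le> exp (\<kappa> * X) * exp (- 2 * \<kappa> * X)"
    proof (rule mult_right_mono)
      have "real (card ?B) \<le> (3 * R) ^ ?d"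
        using R by (intro card_lattice_ball_le) simp
      also have "\<dots> = exp (?d * ln (3 * R))"
        using R by (simp add: exp_of_nat_mult)
      also have "\<dots> \<le> exp (\<kappa> * X)"
      proof -
        \<comment> \<open>Since \<open>ln (3 * R) \<le> 3 * R\<close> and \<open>L \<le> R\<close>, the bound \<open>A \<ge> 3 * d / \<kappa>\<close> is enough.\<close>
        have "?d * ln (3 * R) \<le> ?d * (3 * R)"
          using R ln_le_minus_one[of "3 * R"] by (intro mult_left_mono) auto
        also have "\<dots> = 3 * ?d * R\<^sup>2 / R"
          using R by (simp add: power2_eq_square)
        also have "\<dots> \<le> 3 * ?d * R\<^sup>2 / L"
          using R L by (intro divide_left_mono) auto
        also have "\<dots> \<le> \<kappa> * A * R\<^sup>2 / L"
          using A \<kappa> L by (intro divide_right_mono mult_right_mono) (auto simp: field_simps)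
        finally show ?thesis by (simp add: X_def)
      qed
      finally show "real (card ?B) \<le> exp (\<kappa> * X)" .
    qed simp
    also have "\<dots> = exp (- \<kappa> * X)"
      by (simp add: exp_add[symmetric])
    finally show "\<P>(\<xi> in ?M. \<not> ?B \<subseteq> idla_cluster xs \<xi>)
        \<le> exp (- \<kappa> * (A * R\<^sup>2 / (if ?d = 2 then ln R else 1)))"
      by (simp add: X_def L_def)
  qed
qed

theorem lemma1p3:
  assumes "CARD('d::finite) \<ge> 2"
  shows "\<exists>\<kappa>>0. \<exists>R0 A0 :: real. \<forall>R\<ge>R0. \<forall>A\<ge>A0.
    \<forall>(\<eta> :: (int ^ 'd) multiset) xs.
      set_mset \<eta> \<subseteq> lattice_ball 0 (R / 2) \<and>
      int (size \<eta>) = \<lfloor>A * R ^ CARD('d)\<rfloor> \<and>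
      mset xs = \<eta> \<longrightarrow>
      (CARD('d) \<ge> 3 \<longrightarrow>
        \<P>(\<xi> in walk_steps. \<not> lattice_ball 0 R \<subseteq> idla_cluster xs \<xi>)
          \<le> exp (- \<kappa> * A * R\<^sup>2)) \<and>
      (CARD('d) = 2 \<longrightarrow>
        \<P>(\<xi> in walk_steps. \<not> lattice_ball 0 R \<subseteq> idla_cluster xs \<xi>)
          \<le> exp (- \<kappa> * (A * R\<^sup>2 / ln R)))"
proof -
  obtain \<kappa> A0 where \<kappa>: "\<kappa> > 0"
    and bound: "\<And>R A (xs :: (int ^ 'd) list). \<lbrakk>R \<ge> 2; A \<ge> A0; set xs \<subseteq> lattice_ball 0 (R / 2);
      int (length xs) = \<lfloor>A * R ^ CARD('d)\<rfloor>\<rbrakk>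
      \<Longrightarrow> \<P>(\<xi> in walk_steps. \<not> lattice_ball 0 R \<subseteq> idla_cluster xs \<xi>)
        \<le> exp (- \<kappa> * (A * R\<^sup>2 / (if CARD('d) = 2 then ln R else 1)))"
    by (rule prob_uncovered_ball[OF assms]) (rule that)
  show ?thesis
  proof (rule exI[of _ \<kappa>], rule conjI[OF \<kappa>], rule exI[of _ 2], rule exI[of _ A0], intro allI impI)
    fix R A :: real and \<eta> :: "(int ^ 'd) multiset" and xs
    assume "2 \<le> R" "A0 \<le> A" and "set_mset \<eta> \<subseteq> lattice_ball 0 (R / 2) \<and>
      int (size \<eta>) = \<lfloor>A * R ^ CARD('d)\<rfloor> \<and> mset xs = \<eta>"
    then have "\<P>(\<xi> in walk_steps. \<not> lattice_ball 0 R \<subseteq> idla_cluster xs \<xi>)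
        \<le> exp (- \<kappa> * (A * R\<^sup>2 / (if CARD('d) = 2 then ln R else 1)))"
      by (intro bound) auto
    then show "(CARD('d) \<ge> 3 \<longrightarrow>
        \<P>(\<xi> in walk_steps. \<not> lattice_ball 0 R \<subseteq> idla_cluster xs \<xi>)
          \<le> exp (- \<kappa> * A * R\<^sup>2)) \<and>
      (CARD('d) = 2 \<longrightarrow>
        \<P>(\<xi> in walk_steps. \<not> lattice_ball 0 R \<subseteq> idla_cluster xs \<xi>)
          \<le> exp (- \<kappa> * (A * R\<^sup>2 / ln R)))"
      by (auto simp: mult.assoc)
  qed
qed

end
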